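(* Let $0<H<1$. For any $0<\rho<1/2$, $T>1$ and $\delta>0$ we have, almost surely as $n\to\infty$, $$\sup_{(t,\alpha)\in[0,T]\times[\rho,1-\rho]}\left|t^H v_n(t,\tau_\alpha(t))+\frac{\exp\left(-\frac{z_\alpha^2}{2}\right)}{\sqrt{2\pi}}\,u_n(t,\alpha)\right| = O\left(n^{-1/6+\delta}\right).$$
   Context: Let $0<H<1$ and let $B, B_1,B_2,\dots$ be i.i.d. sample continuous fractional Brownian motions on $[0,\infty)$ with Hurst index $H$, i.e. continuous centered Gaussian processes with $E(B(s)B(t))=\frac12(|s|^{2H}+|t|^{2H}-|s-t|^{2H})$. Versions are chosen so that for every trajectory and every $0<T<\infty$, $\sup_{0\le s\le t\le T}|B(t)-B(s)|/f_H(t-s)<\infty$, where $f_H(u)=u^H\sqrt{1\vee\log u^{-1}}$ (and likewise for each $B_j$). For $t\ge0$, $x\in\mathbb{R}$: $F(t,x)=P\{B(t)\le x\}$ (so $F(t,x)=\Phi(x/t^H)$ for $t>0$, with $\Phi$ the standard normal distribution function); $F_n(t,x)=n^{-1}\sum_{j=1}^n 1\{B_j(t)\le x\}$; $v_n(t,x)=\sqrt n\,\{F_n(t,x)-F(t,x)\}$. For $\alpha\in(0,1)$: $z_\alpha$ is defined by $\Phi(z_\alpha)=\alpha$; $\tau_\alpha(t)=\inf\{x:F(t,x)\ge\alpha\}=t^H z_\alpha$; $\tau^n_\alpha(t)=\inf\{x:F_n(t,x)\ge\alpha\}$; $u_n(t,\alpha)=\sqrt n\,(\tau^n_\alpha(t)-\tau_\alpha(t))$.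 At $t=0$ the same formulas are used, so that $\tau_\alpha(0)=\tau^n_\alpha(0)=0$ and $u_n(0,\alpha)=0$. *)

theory Defs
  imports "HOL-Probability.Probability"
begin

text \<open>
  A real random variable is Gaussian if its law is normal; the degenerate case of variance zero
  is a point mass.
\<close>

definition gaussian_rv :: "'a measure \<Rightarrow> ('a \<Rightarrow> real) \<Rightarrow> bool" where
  "gaussian_rv M X \<longleftrightarrow> X \<in> borel_measurable M \<and>
     (\<exists>\<mu> \<sigma>. \<sigma> \<ge> 0 \<and> distr M borel X =
        (if \<sigma> = 0 then return borel \<mu> else density lborel (\<lambda>x. ennreal (normal_density \<mu> \<sigma> x))))"

text \<open>Processes have type \<^typ>\<open>real \<Rightarrow> 'a \<Rightarrow> real\<close>; only the times \<open>t \<ge> 0\<close> matter.\<close>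

definition gaussian_process :: "'a measure \<Rightarrow> (real \<Rightarrow> 'a \<Rightarrow> real) \<Rightarrow> bool" where
  "gaussian_process M X \<longleftrightarrow>
     (\<forall>I c. finite I \<and> I \<subseteq> {0..} \<longrightarrow> gaussian_rv M (\<lambda>\<omega>. \<Sum>t\<in>I. c t * X t \<omega>))"

definition fractional_BM :: "'a measure \<Rightarrow> real \<Rightarrow> (real \<Rightarrow> 'a \<Rightarrow> real) \<Rightarrow> bool" where
  "fractional_BM M H X \<longleftrightarrow>
     gaussian_process M X \<and>
     (\<forall>t\<ge>0. prob_space.expectation M (X t) = 0) \<and>
     (\<forall>s\<ge>0. \<forall>t\<ge>0. prob_space.expectation M (\<lambda>\<omega>. X s \<omega> * X t \<omega>) =
        (\<bar>s\<bar> powr (2 * H) + \<bar>t\<bar> powr (2 * H) - \<bar>s - t\<bar> powr (2 * H)) / 2) \<and>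
     (\<forall>\<omega>\<in>space M. continuous_on {0..} (\<lambda>t. X t \<omega>))"

definition f_mod :: "real \<Rightarrow> real \<Rightarrow> real" where
  "f_mod H u = u powr H * sqrt (max 1 (ln (1 / u)))"

text \<open>The pairs with \<open>s = t\<close> contribute \<open>0 / 0 = 0\<close> to the supremum below.\<close>

definition modulus_bounded :: "'a measure \<Rightarrow> real \<Rightarrow> (real \<Rightarrow> 'a \<Rightarrow> real) \<Rightarrow> bool" where
  "modulus_bounded M H X \<longleftrightarrow>
     (\<forall>\<omega>\<in>space M. \<forall>T>0.
        bdd_above {\<bar>X t \<omega> - X s \<omega>\<bar> / f_mod H (t - s) | s t. 0 \<le> s \<and> s \<le> t \<and> t \<le> T})"

text \<open>The trajectory of a process, as an element of the product space over the times \<open>t \<ge> 0\<close>.\<close>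

definition trajectory :: "(real \<Rightarrow> 'a \<Rightarrow> real) \<Rightarrow> 'a \<Rightarrow> real \<Rightarrow> real" where
  "trajectory X \<omega> = (\<lambda>t\<in>{0..}. X t \<omega>)"

definition trajectory_space :: "(real \<Rightarrow> real) measure" where
  "trajectory_space = (\<Pi>\<^sub>M t\<in>{0::real..}. (borel :: real measure))"

text \<open>\<open>B 0\<close> is the generic process and \<open>B 1, B 2, \<dots>\<close> is the sample.\<close>

definition iid_fractional_BMs :: "'a measure \<Rightarrow> real \<Rightarrow> (nat \<Rightarrow> real \<Rightarrow> 'a \<Rightarrow> real) \<Rightarrow> bool" where
  "iid_fractional_BMs M H B \<longleftrightarrow>
     (\<forall>j. fractional_BM M H (B j) \<and> modulus_bounded M H (B j)) \<and>
     prob_space.indep_vars M (\<lambda>_. trajectory_space) (\<lambda>j. trajectory (B j)) UNIV \<and>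
     (\<forall>j. distr M trajectory_space (trajectory (B j)) = distr M trajectory_space (trajectory (B 0)))"

definition F_cdf :: "'a measure \<Rightarrow> (nat \<Rightarrow> real \<Rightarrow> 'a \<Rightarrow> real) \<Rightarrow> real \<Rightarrow> real \<Rightarrow> real" where
  "F_cdf M B t x = measure M {\<omega> \<in> space M. B 0 t \<omega> \<le> x}"

definition F_emp :: "(nat \<Rightarrow> real \<Rightarrow> 'a \<Rightarrow> real) \<Rightarrow> nat \<Rightarrow> 'a \<Rightarrow> real \<Rightarrow> real \<Rightarrow> real" where
  "F_emp B n \<omega> t x = (\<Sum>j=1..n. indicator {..x} (B j t \<omega>)) / real n"

definition v_emp ::
  "'a measure \<Rightarrow> (nat \<Rightarrow> real \<Rightarrow> 'a \<Rightarrow> real) \<Rightarrow> nat \<Rightarrow> 'a \<Rightarrow> real \<Rightarrow> real \<Rightarrow> real" where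
  "v_emp M B n \<omega> t x = sqrt (real n) * (F_emp B n \<omega> t x - F_cdf M B t x)"

definition z_quantile :: "real \<Rightarrow> real" where
  "z_quantile \<alpha> = (THE z. cdf std_normal_distribution z = \<alpha>)"

definition tau :: "'a measure \<Rightarrow> (nat \<Rightarrow> real \<Rightarrow> 'a \<Rightarrow> real) \<Rightarrow> real \<Rightarrow> real \<Rightarrow> real" where
  "tau M B \<alpha> t = Inf {x. F_cdf M B t x \<ge> \<alpha>}"

definition tau_emp :: "(nat \<Rightarrow> real \<Rightarrow> 'a \<Rightarrow> real) \<Rightarrow> nat \<Rightarrow> 'a \<Rightarrow> real \<Rightarrow> real \<Rightarrow> real" where
  "tau_emp B n \<omega> \<alpha> t = Inf {x. F_emp B n \<omega> t x \<ge> \<alpha>}"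

definition u_emp ::
  "'a measure \<Rightarrow> (nat \<Rightarrow> real \<Rightarrow> 'a \<Rightarrow> real) \<Rightarrow> nat \<Rightarrow> 'a \<Rightarrow> real \<Rightarrow> real \<Rightarrow> real" where
  "u_emp M B n \<omega> t \<alpha> = sqrt (real n) * (tau_emp B n \<omega> \<alpha> t - tau M B \<alpha> t)"

end

theory Submission
  imports Defs "HOL-Real_Asymp.Real_Asymp"
begin

text \<open>
  Divide by the standard deviation: \<open>B j t / t powr H\<close> is standard normal, and the quantity in
  question is \<open>t powr H * sqrt n\<close> times
  \<open>G z - \<alpha> + phi z * (q - z)\<close>, where \<open>G\<close> is the empirical distribution function of the
  rescaled sample at time \<open>t\<close>, \<open>q\<close> is its \<open>\<alpha>\<close>-quantile and \<open>Phi z = \<alpha>\<close>.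
  For one fixed time this is the classical Bahadur-Kiefer argument, a purely deterministic statement
  (\<open>Bahadur_deterministic\<close>) about the deviation \<open>G - Phi\<close>: if it is at most \<open>d\<close> and
  varies by at most \<open>e \<le> d\<close> over windows of length proportional to \<open>d\<close>, then
  \<open>\<bar>q - z\<bar>\<close> is of order \<open>d\<close> and the error is of order \<open>e + d\<^sup>2\<close>.

  A Chernoff bound whose exponent is proportional to the success probability
  (\<open>Chernoff_indicator\<close>) allows \<open>d = n powr (- 11/24)\<close> and \<open>e = n powr (- 2/3)\<close>
  for a single level or pair of levels outside an event of probability \<open>exp (- n powr (1/24))\<close> up to a constant factor. After
  multiplication by \<open>sqrt n\<close> the error is \<open>O(n powr (- 1/6))\<close>.
  As the failure probability decays faster than any power of \<open>n\<close>, the estimates hold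
  simultaneously on a grid of times and levels of polynomial size (\<open>grid_regular_AE\<close>), almost
  surely for all large \<open>n\<close>.

  Times off the grid are reached through path regularity. The first \<open>n\<close> paths are Hoelder with a
  common constant that grows at most linearly in \<open>n\<close>; this is proved by dyadic chaining and
  Gaussian moments (\<open>fBM_Holder_AE\<close>). On a mesh that is a large power of \<open>1 / n\<close> the rescaled
  sample then moves by at most \<open>1 / n\<close>, and by monotonicity the empirical distribution function is
  squeezed between its values at a grid time and at slightly shifted levels
  (\<open>emp_dev_sandwich\<close>). Rescaling breaks down only for times below \<open>n powr (- 4 / H)\<close>,
  where every term is trivially small (\<open>Bahadur_small_time\<close>).
\<close>

section \<open>The standard normal distribution function\<close>

abbreviation Phi :: "real \<Rightarrow> real" where "Phi \<equiv> cdf std_normal_distribution"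
abbreviation phi :: "real \<Rightarrow> real" where "phi \<equiv> std_normal_density"

lemma Phi_diff_eq_integral:
  assumes "a \<le> b"
  shows "Phi b - Phi a = integral {a..b} phi"
proof -
  interpret real_distribution std_normal_distribution by (rule real_dist_normal_dist)
  have "Phi b - Phi a = measure std_normal_distribution {a<..b}"
    using cdf_diff_eq[of a b] assms by (cases "a = b") auto
  also have "\<dots> = (\<integral>x. indicator {a<..b} x * phi x \<partial>lborel)"
  proof -
    have "emeasure std_normal_distribution {a<..b} = (\<integral>\<^sup>+x. ennreal (indicator {a<..b} x * phi x) \<partial>lborel)"
      by (subst emeasure_density) (auto intro!: nn_integral_cong simp: indicator_def)
    also have "\<dots> = ennreal (\<integral>x. indicator {a<..b} x * phi x \<partial>lborel)"
      using integrable_real_mult_indicator[of "{a<..b}" lborel phi]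
      by (intro nn_integral_eq_integral) (auto simp: mult.commute)
    finally show ?thesis by (simp add: measure_def)
  qed
  also have "\<dots> = (\<integral>x. indicator {a..b} x * phi x \<partial>lborel)"
    by (intro integral_cong_AE) (auto intro: AE_mp[OF AE_lborel_singleton[of a]] simp: indicator_def)
  also have "\<dots> = (LINT x:{a..b}|lborel. phi x)"
    by (simp add: set_lebesgue_integral_def)
  also have "\<dots> = integral {a..b} phi"
    using integrable_real_mult_indicator[of "{a..b}" lborel phi]
    by (intro set_borel_integral_eq_integral) (auto simp: set_integrable_def mult.commute)
  finally show ?thesis .
qed


lemma Phi_has_real_derivative: "(Phi has_real_derivative phi x) (at x)"
proof -
  have cont: "continuous_on A phi" for A
    unfolding std_normal_density_def by (intro continuous_intros) auto
  have "((\<lambda>y. integral {x-1..y} phi) has_real_derivative phi x) (at x within {x-1..x+1})"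
    by (intro integral_has_real_derivative cont) auto
  then have "((\<lambda>y. integral {x-1..y} phi) has_real_derivative phi x) (at x)"
    by (simp add: at_within_Icc_at)
  then have "((\<lambda>y. Phi (x-1) + integral {x-1..y} phi) has_real_derivative phi x) (at x)"
    by (auto intro!: derivative_eq_intros)
  then show ?thesis
    by (rule has_field_derivative_transform_within_open[where S = "{x-1<..<x+1}"])
       (auto simp: Phi_diff_eq_integral[symmetric])
qed

lemma phi_le_one: "phi x \<le> 1"
proof -
  have "1 \<le> sqrt (2 * pi)" using pi_gt3 by simp
  then have "exp (- x\<^sup>2 / 2) / sqrt (2 * pi) \<le> 1 / 1"
    by (intro frac_le) auto
  then show ?thesis by (simp add: std_normal_density_def)
qed

text \<open>
  The derivative of the density is \<open>- z * phi z\<close>, and \<open>\<bar>z\<bar> \<le> 1 + z\<^sup>2 / 2 \<le> exp (z\<^sup>2 / 2)\<close>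
  bounds it by one.
\<close>

lemma phi_lipschitz: "\<bar>phi x - phi y\<bar> \<le> \<bar>x - y\<bar>"
proof -
  have deriv: "(phi has_real_derivative - z * phi z) (at z within UNIV)" for z
  proof -
    define c where "c = 1 / sqrt (2 * pi)"
    show ?thesis
      unfolding std_normal_density_def c_def[symmetric] by (auto intro!: derivative_eq_intros)
  qed
  have "\<bar>- z * phi z\<bar> \<le> 1" for z
  proof -
    have "\<bar>z\<bar> \<le> 1 + z\<^sup>2 / 2"
      using zero_le_power2[of "\<bar>z\<bar> - 1"] by (simp add: power2_diff)
    also have "\<dots> \<le> exp (z\<^sup>2 / 2)"
      by (rule exp_ge_add_one_self)
    finally have "\<bar>z\<bar> * exp (- z\<^sup>2 / 2) \<le> 1"
      by (simp add: exp_minus field_simps)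
    moreover have "1 \<le> sqrt (2 * pi)" using pi_gt3 by simp
    ultimately have "\<bar>z\<bar> * exp (- z\<^sup>2 / 2) / sqrt (2 * pi) \<le> 1 / 1"
      by (intro frac_le) auto
    then show ?thesis by (simp add: std_normal_density_def abs_mult)
  qed
  then have "norm (phi x - phi y) \<le> 1 * norm (x - y)"
    by (intro field_differentiable_bound[of UNIV phi "\<lambda>z. - z * phi z"]) (use deriv in auto)
  then show ?thesis by simp
qed

lemma phi_lower_bound:
  assumes "\<bar>x\<bar> \<le> R"
  shows "phi R \<le> phi x"
  using assms by (auto simp: std_normal_density_def abs_le_square_iff[symmetric] divide_right_mono)

lemma Phi_mean_value: "\<exists>\<xi>. min x y \<le> \<xi> \<and> \<xi> \<le> max x y \<and> Phi y - Phi x = phi \<xi> * (y - x)"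
proof -
  have *: "\<exists>\<xi>. a \<le> \<xi> \<and> \<xi> \<le> b \<and> Phi b - Phi a = phi \<xi> * (b - a)" if "a < b" for a b
    using MVT2[OF that, of Phi phi] Phi_has_real_derivative
    by (metis less_imp_le mult.commute)
  consider "x < y" | "y < x" | "x = y" by linarith
  then show ?thesis
  proof cases
    case 1 then show ?thesis using *[of x y] by auto
  next
    case 2
    then obtain \<xi> where "y \<le> \<xi>" "\<xi> \<le> x" "Phi x - Phi y = phi \<xi> * (x - y)" using * by blast
    then show ?thesis using 2 by (intro exI[of _ \<xi>]) (auto simp: algebra_simps)
  qed auto
qed

lemma Phi_lipschitz: "\<bar>Phi y - Phi x\<bar> \<le> \<bar>y - x\<bar>"
proof -
  obtain \<xi> where "Phi y - Phi x = phi \<xi> * (y - x)" using Phi_mean_value by blast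
  then show ?thesis
    using phi_le_one[of \<xi>] by (simp add: abs_mult mult_left_le_one_le)
qed

text \<open>
  This turns the increment of \<open>Phi\<close> between the true and the empirical quantile into the
  linear term of the Bahadur-Kiefer representation; the quadratic error is negligible because the two
  quantiles are about \<open>n\<close> to the power \<open>- 1/2\<close> apart.
\<close>

lemma Phi_Taylor: "\<bar>Phi y - Phi x - phi x * (y - x)\<bar> \<le> (y - x)\<^sup>2"
proof -
  obtain \<xi> where \<xi>: "min x y \<le> \<xi>" "\<xi> \<le> max x y" "Phi y - Phi x = phi \<xi> * (y - x)"
    using Phi_mean_value by blast
  have "\<bar>phi \<xi> - phi x\<bar> \<le> \<bar>y - x\<bar>"
    using phi_lipschitz[of \<xi> x] \<xi>(1,2) by linarith
  then have "\<bar>phi \<xi> - phi x\<bar> * \<bar>y - x\<bar> \<le> \<bar>y - x\<bar> * \<bar>y - x\<bar>"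
    by (intro mult_right_mono) auto
  then show ?thesis
    by (simp add: \<xi>(3) abs_mult[symmetric] power2_eq_square algebra_simps)
qed

text \<open>
  On a bounded range \<open>Phi\<close> has slope bounded below, so closeness of
  distribution functions forces closeness of quantiles. This is where levels near \<open>0\<close> and \<open>1\<close>
  must be excluded.
\<close>

lemma Phi_increment_lower_bound:
  assumes "\<bar>x\<bar> \<le> R" "\<bar>y\<bar> \<le> R" "x \<le> y"
  shows "phi R * (y - x) \<le> Phi y - Phi x"
proof -
  obtain \<xi> where \<xi>: "min x y \<le> \<xi>" "\<xi> \<le> max x y" "Phi y - Phi x = phi \<xi> * (y - x)"
    using Phi_mean_value by blast
  have "phi R \<le> phi \<xi>" using \<xi> assms by (intro phi_lower_bound) linarith
  then show ?thesis using assms \<xi>(3) by (simp add: mult_right_mono)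
qed

lemma Phi_strict_mono: "strict_mono Phi"
proof (rule strict_monoI)
  fix x y :: real assume "x < y"
  then show "Phi x < Phi y"
    by (intro DERIV_pos_imp_increasing[of x y Phi])
       (auto intro!: exI[of _ "phi _"] Phi_has_real_derivative normal_density_pos)
qed

lemma Phi_surj:
  assumes "0 < \<alpha>" "\<alpha> < 1"
  shows "\<exists>z. Phi z = \<alpha>"
proof -
  interpret real_distribution std_normal_distribution by (rule real_dist_normal_dist)
  obtain a where a: "Phi a < \<alpha>"
    using order_tendstoD(2)[OF cdf_lim_at_bot assms(1)] by (auto simp: eventually_at_bot_linorder)
  obtain b where b: "\<alpha> < Phi b"
    using order_tendstoD(1)[OF cdf_lim_at_top_prob assms(2)] by (auto simp: eventually_at_top_linorder)
  have "a \<le> b" using a b Phi_strict_mono by (meson less_trans linear not_less strict_mono_less_eq order.strict_trans)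
  then show ?thesis
    using IVT'[of Phi a \<alpha> b] a b DERIV_isCont[OF Phi_has_real_derivative]
    by (force intro!: continuous_at_imp_continuous_on)
qed

lemma Phi_z_quantile:
  assumes "0 < \<alpha>" "\<alpha> < 1"
  shows "Phi (z_quantile \<alpha>) = \<alpha>"
proof -
  have "\<exists>!z. Phi z = \<alpha>"
    using Phi_surj[OF assms] strict_mono_eq[OF Phi_strict_mono] by metis
  then show ?thesis unfolding z_quantile_def by (rule theI')
qed

section \<open>A Chernoff bound for counts of independent indicators\<close>

text \<open>
  Both signs of \<open>x\<close> are needed because the Chernoff bound is applied to the upper and to
  the lower tail. For negative \<open>x = - y\<close> the inequality is the reciprocal of
  \<open>exp y \<ge> 1 + y + y\<^sup>2 / 2\<close>.
\<close>

lemma exp_le_quadratic: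
  fixes x :: real
  assumes "\<bar>x\<bar> \<le> 1"
  shows "exp x \<le> 1 + x + x\<^sup>2"
proof (cases "0 \<le> x")
  case True
  then show ?thesis using assms exp_bound[of x] by auto
next
  case False
  define y where "y = - x"
  have y: "0 < y" "y \<le> 1" using False assms by (auto simp: y_def)
  have "1 \<le> (1 - y + y\<^sup>2) * (1 + y + y\<^sup>2 / 2)"
  proof -
    have "(1 - y + y\<^sup>2) * (1 + y + y\<^sup>2 / 2) = 1 + (y\<^sup>2 + y^3 + y^4) / 2"
      by (simp add: field_simps power2_eq_square power3_eq_cube power4_eq_xxxx)
    then show ?thesis using y by simp
  qed
  also have "\<dots> \<le> (1 - y + y\<^sup>2) * exp y"
    using y by (intro mult_left_mono exp_lower_Taylor_quadratic) auto
  finally show ?thesis by (simp add: y_def exp_minus field_simps)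
qed

context prob_space
begin

text \<open>
  The exponent carries \<open>prob A\<close>, the order of the variance of the indicator, instead of a
  constant as in Hoeffding's inequality. The counts over short intervals, where \<open>prob A\<close> is small, are
  controlled only thanks to this factor.
\<close>

lemma expectation_exp_indicator_le:
  assumes [measurable]: "A \<in> events" and "\<bar>\<theta>\<bar> \<le> 1"
  shows "expectation (\<lambda>\<omega>. exp (\<theta> * (indicator A \<omega> - prob A))) \<le> exp (prob A * \<theta>\<^sup>2)"
proof -
  have "expectation (\<lambda>\<omega>. exp (\<theta> * (indicator A \<omega> - prob A)))
      = expectation (\<lambda>\<omega>. exp (- \<theta> * prob A) * (1 + (exp \<theta> - 1) * indicator A \<omega>))"
    by (intro Bochner_Integration.integral_cong refl)
       (auto simp: indicator_def exp_add[symmetric] algebra_simps)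
  also have "\<dots> = exp (- \<theta> * prob A) * (1 + (exp \<theta> - 1) * prob A)"
    by (subst integral_mult_right_zero, subst Bochner_Integration.integral_add)
       (auto simp: prob_space emeasure_eq_measure)
  also have "\<dots> \<le> exp (- \<theta> * prob A) * exp ((\<theta> + \<theta>\<^sup>2) * prob A)"
  proof -
    have "(exp \<theta> - 1) * prob A \<le> (\<theta> + \<theta>\<^sup>2) * prob A"
      using exp_le_quadratic[OF assms(2)] by (intro mult_right_mono) auto
    then have "1 + (exp \<theta> - 1) * prob A \<le> exp ((\<theta> + \<theta>\<^sup>2) * prob A)"
      using exp_ge_add_one_self[of "(\<theta> + \<theta>\<^sup>2) * prob A"] by linarith
    then show ?thesis by (intro mult_left_mono) auto
  qed
  also have "\<dots> = exp (prob A * \<theta>\<^sup>2)"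
    by (simp add: exp_add[symmetric] algebra_simps)
  finally show ?thesis .
qed

lemma Chernoff_indicator_signed:
  assumes I: "finite I" and indep: "indep_vars (\<lambda>_. borel) X I"
    and S: "S \<in> sets borel"
    and p: "\<And>i. i \<in> I \<Longrightarrow> prob {\<omega> \<in> space M. X i \<omega> \<in> S} = p"
    and \<theta>: "\<bar>\<theta>\<bar> \<le> 1"
  shows "prob {\<omega> \<in> space M. b \<le> \<theta> * ((\<Sum>i\<in>I. indicator S (X i \<omega>)) - real (card I) * p)}
           \<le> exp (real (card I) * p * \<theta>\<^sup>2 - b)"
proof -
  have [measurable]: "i \<in> I \<Longrightarrow> X i \<in> borel_measurable M" for i
    using indep by (auto simp: indep_vars_def)
  note S [measurable]
  define Y where "Y i \<omega> = exp (\<theta> * (indicator S (X i \<omega>) - p))" for i \<omega>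
  have indepY: "indep_vars (\<lambda>_. borel) Y I"
    unfolding Y_def by (rule indep_vars_compose2[OF indep]) measurable
  have Y_meas [measurable]: "i \<in> I \<Longrightarrow> Y i \<in> borel_measurable M" for i
    using indepY by (auto simp: indep_vars_def)
  have Y_bdd: "norm (Y i \<omega>) \<le> exp (\<bar>\<theta>\<bar> * (1 + \<bar>p\<bar>))" for i \<omega>
  proof -
    have "\<bar>\<theta> * (indicator S (X i \<omega>) - p)\<bar> \<le> \<bar>\<theta>\<bar> * (1 + \<bar>p\<bar>)"
      unfolding abs_mult by (intro mult_left_mono) (auto simp: indicator_def)
    then show ?thesis by (simp add: Y_def abs_le_iff)
  qed
  have Y_int: "integrable M (Y i)" if "i \<in> I" for i
    using that Y_bdd by (intro integrable_const_bound[where B = "exp (\<bar>\<theta>\<bar> * (1 + \<bar>p\<bar>))"]) auto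
  have Y_exp: "expectation (Y i) \<le> exp (p * \<theta>\<^sup>2)" if "i \<in> I" for i
  proof -
    let ?A = "{\<omega> \<in> space M. X i \<omega> \<in> S}"
    have A: "?A \<in> events" using that by measurable
    have "expectation (Y i) = expectation (\<lambda>\<omega>. exp (\<theta> * (indicator ?A \<omega> - prob ?A)))"
      using that by (intro Bochner_Integration.integral_cong) (auto simp: Y_def p indicator_def)
    also have "\<dots> \<le> exp (p * \<theta>\<^sup>2)"
      using expectation_exp_indicator_le[OF A \<theta>] that by (simp add: p)
    finally show ?thesis .
  qed
  have prod_eq: "(\<Prod>i\<in>I. Y i \<omega>) = exp (\<theta> * ((\<Sum>i\<in>I. indicator S (X i \<omega>)) - real (card I) * p))" for \<omega>
    unfolding Y_def exp_sum[OF I, symmetric] by (simp add: sum_distrib_left[symmetric] sum_subtractf)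
  have "prob {\<omega> \<in> space M. b \<le> \<theta> * ((\<Sum>i\<in>I. indicator S (X i \<omega>)) - real (card I) * p)}
      = prob {\<omega> \<in> space M. exp b \<le> (\<Prod>i\<in>I. Y i \<omega>)}"
    by (simp add: prod_eq)
  also have "\<dots> \<le> expectation (\<lambda>\<omega>. \<Prod>i\<in>I. Y i \<omega>) / exp b"
    using indep_vars_integrable[OF I indepY Y_int]
    by (intro integral_Markov_inequality_measure[where A = "space M"])
       (auto intro!: prod_nonneg simp: Y_def)
  also have "\<dots> = (\<Prod>i\<in>I. expectation (Y i)) / exp b"
    by (subst indep_vars_lebesgue_integral[OF I indepY]) (auto intro: Y_int)
  also have "\<dots> \<le> (\<Prod>i\<in>I. exp (p * \<theta>\<^sup>2)) / exp b"
    by (intro divide_right_mono prod_mono conjI Y_exp Bochner_Integration.integral_nonneg) (auto simp: Y_def)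
  also have "\<dots> = exp (real (card I) * p * \<theta>\<^sup>2 - b)"
    by (simp add: exp_diff exp_of_nat_mult[symmetric] mult.assoc)
  finally show ?thesis .
qed

text \<open>
  With \<open>card I = n\<close> this bounds the fluctuations of a binomial count at scale
  \<open>sqrt (n * p)\<close> up to subpolynomial factors, with a stretched exponential probability of failure
  that survives a union over polynomially many events.
\<close>

lemma Chernoff_indicator:
  assumes I: "finite I" and indep: "indep_vars (\<lambda>_. borel) X I"
    and S: "S \<in> sets borel"
    and p: "\<And>i. i \<in> I \<Longrightarrow> prob {\<omega> \<in> space M. X i \<omega> \<in> S} = p"
    and \<theta>: "0 < \<theta>" "\<theta> \<le> 1"
  shows "prob {\<omega> \<in> space M. \<bar>(\<Sum>i\<in>I. indicator S (X i \<omega>)) - real (card I) * p\<bar> \<ge> a}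
           \<le> 2 * exp (real (card I) * p * \<theta>\<^sup>2 - \<theta> * a)"
proof -
  have [measurable]: "i \<in> I \<Longrightarrow> X i \<in> borel_measurable M" for i
    using indep by (auto simp: indep_vars_def)
  note S [measurable]
  let ?D = "\<lambda>\<omega>. (\<Sum>i\<in>I. indicator S (X i \<omega>)) - real (card I) * p"
  let ?E = "\<lambda>l. {\<omega> \<in> space M. \<theta> * a \<le> l * ?D \<omega>}"
  have "prob {\<omega> \<in> space M. \<bar>?D \<omega>\<bar> \<ge> a} \<le> prob (?E \<theta> \<union> ?E (- \<theta>))"
  proof (rule finite_measure_mono)
    have "\<theta> * a \<le> \<theta> * d \<or> \<theta> * a \<le> - \<theta> * d" if "a \<le> \<bar>d\<bar>" for d
    proof -
      have "a \<le> d \<or> a \<le> - d" using that by linarith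
      then show ?thesis using \<theta>(1) mult_left_mono[of a d \<theta>] mult_left_mono[of a "-d" \<theta>] by auto
    qed
    then show "{\<omega> \<in> space M. \<bar>?D \<omega>\<bar> \<ge> a} \<subseteq> ?E \<theta> \<union> ?E (- \<theta>)" by blast
  qed measurable
  also have "\<dots> \<le> prob (?E \<theta>) + prob (?E (- \<theta>))"
    by (rule measure_Un_le) measurable
  also have "\<dots> \<le> 2 * exp (real (card I) * p * \<theta>\<^sup>2 - \<theta> * a)"
    using Chernoff_indicator_signed[OF I indep S p, of \<theta> "\<theta> * a"]
      Chernoff_indicator_signed[OF I indep S p, of "- \<theta>" "\<theta> * a"] \<theta> by simp
  finally show ?thesis .
qed

end

section \<open>Dyadic chaining\<close>

text \<open>
  Continuity transfers estimates on dyadic points to all points along this sequence.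
\<close>

lemma dyadic_floor_tendsto: "(\<lambda>k. of_int \<lfloor>x * 2 ^ k\<rfloor> / 2 ^ k) \<longlonglongrightarrow> (x::real)"
proof (rule real_tendsto_sandwich)
  show "\<forall>\<^sub>F k in sequentially. x - (1/2)^k \<le> of_int \<lfloor>x * 2 ^ k\<rfloor> / 2 ^ k"
  proof (intro always_eventually allI)
    fix k :: nat
    have "x * 2^k - 1 \<le> of_int \<lfloor>x * 2 ^ k\<rfloor>" by linarith
    then show "x - (1/2)^k \<le> of_int \<lfloor>x * 2 ^ k\<rfloor> / 2 ^ k"
      using divide_right_mono[of "x * 2^k - 1" "of_int \<lfloor>x * 2 ^ k\<rfloor>" "2 ^ k"]
      by (simp add: diff_divide_distrib power_divide)
  qed
  show "\<forall>\<^sub>F k in sequentially. of_int \<lfloor>x * 2 ^ k\<rfloor> / 2 ^ k \<le> x"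
    by (intro always_eventually allI) (simp add: field_simps)
  have "(\<lambda>k. x - (1/2)^k) \<longlonglongrightarrow> x - 0"
    by (intro tendsto_diff tendsto_const LIMSEQ_realpow_zero) auto
  then show "(\<lambda>k. x - (1/2)^k) \<longlonglongrightarrow> x" by simp
qed simp

text \<open>
  The dyadic truncations of \<open>x\<close> at successive levels either coincide or are neighbours at
  the finer level, so the distance telescopes into a geometric series in \<open>r\<close>.
\<close>

lemma dyadic_chain_bound:
  fixes g :: "real \<Rightarrow> real" and A r x :: real
  assumes cont: "continuous_on {0..1} g"
    and A: "0 \<le> A" and r: "0 < r" "r < 1"
    and incr: "\<And>k i. i < 2 ^ k \<Longrightarrow> \<bar>g (real (Suc i) / 2 ^ k) - g (real i / 2 ^ k)\<bar> \<le> A * r ^ k"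
    and x: "x \<in> {0..1}"
  shows "\<bar>g x - g (of_int \<lfloor>x * 2 ^ k\<rfloor> / 2 ^ k)\<bar> \<le> A * r ^ (k+1) / (1 - r)"
proof -
  define d where "d l = of_int \<lfloor>x * 2 ^ l\<rfloor> / (2 ^ l :: real)" for l :: nat
  have d01: "d l \<in> {0..1}" for l
  proof -
    have "of_int \<lfloor>x * 2 ^ l\<rfloor> \<le> x * 2 ^ l" by simp
    also have "\<dots> \<le> 2 ^ l" using x by (simp add: mult_left_le_one_le)
    finally show ?thesis using x by (simp add: d_def)
  qed
  have step: "\<bar>g (d (Suc l)) - g (d l)\<bar> \<le> A * r ^ Suc l" for l
  proof -
    define m where "m = \<lfloor>x * 2 ^ l\<rfloor>"
    have m0: "0 \<le> m" using x by (simp add: m_def)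
    have "\<lfloor>x * 2 ^ Suc l\<rfloor> = 2 * m \<or> \<lfloor>x * 2 ^ Suc l\<rfloor> = 2 * m + 1"
    proof -
      have "of_int m \<le> x * 2 ^ l" "x * 2 ^ l < of_int m + 1" by (simp_all add: m_def)
      then have "of_int (2 * m) \<le> x * 2 ^ Suc l" "x * 2 ^ Suc l < of_int (2 * m + 2)" by simp_all
      then have "2 * m \<le> \<lfloor>x * 2 ^ Suc l\<rfloor>" "\<lfloor>x * 2 ^ Suc l\<rfloor> < 2 * m + 2"
        by (simp_all only: le_floor_iff floor_less_iff)
      then show ?thesis by linarith
    qed
    then show ?thesis
    proof
      assume *: "\<lfloor>x * 2 ^ Suc l\<rfloor> = 2 * m"
      have "d (Suc l) = d l" unfolding d_def * m_def[symmetric] by (simp add: field_simps)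
      then show ?thesis using A r by simp
    next
      assume *: "\<lfloor>x * 2 ^ Suc l\<rfloor> = 2 * m + 1"
      define i where "i = nat (2 * m)"
      have dl: "d l = real i / 2 ^ Suc l" using m0 by (simp add: d_def i_def m_def[symmetric])
      have dS: "d (Suc l) = real (Suc i) / 2 ^ Suc l" using m0 by (simp add: d_def i_def * del: power_Suc)
      have "real (Suc i) \<le> 2 ^ Suc l"
        using d01[of "Suc l"] unfolding dS by (simp add: field_simps)
      then have "Suc i \<le> 2 ^ Suc l"
        by (metis of_nat_le_iff of_nat_numeral of_nat_power)
      then show ?thesis using incr[of i "Suc l"] by (simp add: dl dS del: power_Suc)
    qed
  qed
  have tele: "\<bar>g (d (k + l)) - g (d k)\<bar> \<le> A * r ^ (k+1) * (1 - r ^ l) / (1 - r)" for l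
  proof (induction l)
    case (Suc l)
    have "\<bar>g (d (k + Suc l)) - g (d k)\<bar> \<le> A * r ^ (k+1) * (1 - r ^ l) / (1 - r) + A * r ^ Suc (k + l)"
      using Suc step[of "k + l"] by simp
    also have "\<dots> = A * r ^ (k+1) * (1 - r ^ Suc l) / (1 - r)"
      using r by (simp add: field_simps power_add)
    finally show ?case .
  qed simp
  have bound: "\<bar>g (d (k + l)) - g (d k)\<bar> \<le> A * r ^ (k+1) / (1 - r)" for l
  proof -
    have "A * r ^ (k+1) * (1 - r ^ l) / (1 - r) \<le> A * r ^ (k+1) * 1 / (1 - r)"
      using A r by (intro divide_right_mono mult_left_mono) auto
    then show ?thesis using tele[of l] by simp
  qed
  have "d \<longlonglongrightarrow> x" unfolding d_def by (rule dyadic_floor_tendsto)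
  then have "(\<lambda>l. d (k + l)) \<longlonglongrightarrow> x" by (subst add.commute) (rule LIMSEQ_ignore_initial_segment)
  then have "(\<lambda>l. g (d (k + l))) \<longlonglongrightarrow> g x"
    using cont x d01 by (intro continuous_on_tendsto_compose[OF cont]) auto
  then have "(\<lambda>l. \<bar>g (d (k + l)) - g (d k)\<bar>) \<longlonglongrightarrow> \<bar>g x - g (d k)\<bar>"
    by (intro tendsto_intros)
  then have "\<bar>g x - g (d k)\<bar> \<le> A * r ^ (k+1) / (1 - r)"
    by (rule LIMSEQ_le_const2) (use bound in auto)
  then show ?thesis by (simp add: d_def)
qed

text \<open>
  Two geometric tails \<open>r / (1 - r)\<close> with \<open>r = 2 powr (- \<beta>)\<close>, one for each
  end point, plus one step between neighbours; the factor \<open>2 powr \<beta>\<close> is the loss from rounding the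
  distance of the two points up to a power of two.
\<close>

definition chaining_const :: "real \<Rightarrow> real" where
  "chaining_const \<beta> = 2 powr \<beta> * (1 + 2 * 2 powr (- \<beta>) / (1 - 2 powr (- \<beta>)))"

lemma chaining_const_pos: "0 < \<beta> \<Longrightarrow> 0 < chaining_const \<beta>"
  unfolding chaining_const_def
  using powr_less_one[of 2 "- \<beta>"] by (intro mult_pos_pos add_pos_nonneg divide_nonneg_nonneg) auto

text \<open>
  At the level \<open>k\<close> whose mesh is comparable with \<open>\<bar>y - x\<bar>\<close>, the truncations of
  \<open>x\<close> and \<open>y\<close> are equal or adjacent; the remaining distances are handled by
  \<open>dyadic_chain_bound\<close>.
\<close>

lemma dyadic_increments_imp_Holder:
  fixes g :: "real \<Rightarrow> real"
  assumes cont: "continuous_on {0..1} g"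
    and A: "0 \<le> A" and \<beta>: "0 < \<beta>"
    and incr: "\<And>k i. i < 2 ^ k \<Longrightarrow> \<bar>g (real (Suc i) / 2 ^ k) - g (real i / 2 ^ k)\<bar> \<le> A * 2 powr (- \<beta> * real k)"
    and xy: "x \<in> {0..1}" "y \<in> {0..1}"
  shows "\<bar>g y - g x\<bar> \<le> chaining_const \<beta> * A * \<bar>y - x\<bar> powr \<beta>"
proof -
  define r :: real where "r = 2 powr (- \<beta>)"
  have r: "0 < r" "r < 1" using \<beta> by (auto simp: r_def powr_less_one)
  have rk: "2 powr (- \<beta> * real k) = r ^ k" for k
    using r(1) by (simp only: r_def powr_powr[symmetric] powr_realpow)
  note incr' = incr[unfolded rk]
  have main: "\<bar>g y - g x\<bar> \<le> chaining_const \<beta> * A * \<bar>y - x\<bar> powr \<beta>"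
    if xy: "x \<in> {0..1}" "y \<in> {0..1}" and "x < y" for x y
  proof -
    define h where "h = y - x"
    have h: "0 < h" "h \<le> 1" using that by (auto simp: h_def)
    obtain N where "(1/2) ^ N < h" using real_arch_pow_inv[OF h(1), of "1/2"] by auto
    then have ex: "\<exists>k. (1/2::real) ^ Suc k < h"
      using power_decreasing[of N "Suc N" "1/2::real"] by (intro exI[of _ N]) linarith
    \<comment> \<open>The level with \<open>(1/2) ^ Suc k < h \<le> (1/2) ^ k\<close>.\<close>
    define k where "k = (LEAST k. (1/2::real) ^ Suc k < h)"
    have k1: "(1/2) ^ Suc k < h" unfolding k_def by (rule LeastI_ex[OF ex])
    have k2: "h \<le> (1/2) ^ k"
    proof (cases k)
      case 0 then show ?thesis using h by simp
    next
      case (Suc l)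
      then have "\<not> (1/2) ^ Suc l < h" using not_less_Least[of l "\<lambda>k. (1/2::real) ^ Suc k < h"] k_def by simp
      then show ?thesis using Suc by simp
    qed
    let ?X = "\<lfloor>x * 2 ^ k\<rfloor>" and ?Y = "\<lfloor>y * 2 ^ k\<rfloor>"
    have "?X \<le> ?Y" using \<open>x < y\<close> by (intro floor_mono) simp
    moreover have "?Y \<le> ?X + 1"
    proof -
      have "(y - x) * 2 ^ k \<le> 1"
        using k2 by (simp add: h_def field_simps power_divide)
      then have "y * 2 ^ k < of_int ?X + 2" by (simp add: algebra_simps) linarith
      then show ?thesis by linarith
    qed
    ultimately have "?Y = ?X \<or> ?Y = ?X + 1" by linarith
    then have mid: "\<bar>g (of_int ?Y / 2 ^ k) - g (of_int ?X / 2 ^ k)\<bar> \<le> A * r ^ k"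
    proof
      assume "?Y = ?X" then show ?thesis using A r by simp
    next
      assume *: "?Y = ?X + 1"
      define i where "i = nat ?X"
      have i: "of_int ?X = real i" "of_int ?Y = real (Suc i)" using xy * by (auto simp: i_def)
      have "of_int ?Y \<le> y * 2 ^ k" by simp
      also have "\<dots> \<le> 2 ^ k" using xy by (simp add: mult_left_le_one_le)
      finally have "real (Suc i) \<le> 2 ^ k" using i by simp
      then have "Suc i \<le> 2 ^ k" by (metis of_nat_le_iff of_nat_numeral of_nat_power)
      then show ?thesis using incr'[of i k] by (simp add: i)
    qed
    have "\<bar>g y - g x\<bar> \<le> A * r ^ (k+1) / (1 - r) + A * r ^ k + A * r ^ (k+1) / (1 - r)"
      using dyadic_chain_bound[OF cont A r incr' xy(1), of k]
        dyadic_chain_bound[OF cont A r incr' xy(2), of k] mid by linarith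
    also have "\<dots> = A * (1 + 2 * r / (1 - r)) * r ^ k"
      by (simp add: distrib_left distrib_right)
    also have "\<dots> \<le> A * (1 + 2 * r / (1 - r)) * (2 powr \<beta> * h powr \<beta>)"
    proof (intro mult_left_mono)
      have "(1/2::real) ^ k = 2 powr (- real k)"
        by (simp add: powr_minus powr_realpow power_divide inverse_eq_divide)
      then have "r ^ k = ((1/2) ^ k) powr \<beta>"
        by (simp only: rk[symmetric] powr_powr) (simp add: mult.commute)
      also have "\<dots> \<le> (2 * h) powr \<beta>"
        using less_imp_le[OF k1] \<beta> by (intro powr_mono2) simp_all
      also have "(2 * h) powr \<beta> = 2 powr \<beta> * h powr \<beta>" using h by (intro powr_mult)
      finally show "r ^ k \<le> 2 powr \<beta> * h powr \<beta>" .
    qed (use A r in auto)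
    finally have "\<bar>g y - g x\<bar> \<le> A * (1 + 2 * r / (1 - r)) * (2 powr \<beta> * h powr \<beta>)" .
    moreover have "\<bar>y - x\<bar> = h" using \<open>x < y\<close> by (simp add: h_def)
    ultimately show ?thesis
      unfolding chaining_const_def r_def[symmetric] by (simp only: mult_ac)
  qed
  consider "x < y" | "y < x" | "x = y" by linarith
  then show ?thesis
  proof cases
    case 1 then show ?thesis by (intro main xy)
  next
    case 2 then show ?thesis
      using main[OF xy(2,1)] by (simp only: abs_minus_commute)
  qed simp
qed

section \<open>Gaussian moments and fractional Brownian increments\<close>

context prob_space
begin

text \<open>
  The law in \<open>gaussian_rv\<close> may be a point mass, which occurs here at time zero and for
  increments over an empty interval; centering identifies the point.
\<close>

lemma gaussian_rv_centered_cases: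
  assumes "gaussian_rv M X" and "expectation X = 0"
  obtains "AE \<omega> in M. X \<omega> = 0"
  | \<sigma> where "0 < \<sigma>" "distributed M lborel X (normal_density 0 \<sigma>)"
proof -
  from assms(1) obtain \<mu> \<sigma> where [measurable]: "X \<in> borel_measurable M" and "0 \<le> \<sigma>"
    and D: "distr M borel X =
        (if \<sigma> = 0 then return borel \<mu> else density lborel (\<lambda>x. ennreal (normal_density \<mu> \<sigma> x)))"
    by (auto simp: gaussian_rv_def)
  have E: "(\<integral>x. x \<partial>distr M borel X) = 0"
    using assms(2) by (subst integral_distr) auto
  show ?thesis
  proof (cases "\<sigma> = 0")
    case True
    then have "\<mu> = 0" using E D by (simp add: integral_return)
    then have "AE x in distr M borel X. x = 0" unfolding D using True by (simp, subst AE_return) auto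
    then show ?thesis using that(1) by (simp add: AE_distr_iff)
  next
    case False
    then have \<sigma>: "0 < \<sigma>" using \<open>0 \<le> \<sigma>\<close> by simp
    have "(\<integral>x. x \<partial>distr M borel X) = \<mu>"
      using D False integral_normal_moment_nz_1[OF \<sigma>, of \<mu>] by (simp add: integral_density)
    then have "\<mu> = 0" using E by simp
    moreover have "distributed M lborel X (normal_density \<mu> \<sigma>)"
      using D False distr_cong[OF refl sets_lborel refl, of M X] by (auto simp: distributed_def)
    ultimately show ?thesis using that(2)[OF \<sigma>] by simp
  qed
qed

lemma centered_gaussian_integrable_power:
  assumes "gaussian_rv M X" and "expectation X = 0"
  shows "integrable M (\<lambda>\<omega>. X \<omega> ^ k)"
proof -
  have [measurable]: "X \<in> borel_measurable M" using assms by (simp add: gaussian_rv_def)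
  show ?thesis
  proof (cases rule: gaussian_rv_centered_cases[OF assms])
    case 1
    then have "integrable M (\<lambda>\<omega>. X \<omega> ^ k) \<longleftrightarrow> integrable M (\<lambda>\<omega>. 0 ^ k :: real)"
      by (intro integrable_cong_AE) auto
    then show ?thesis by simp
  next
    case (2 \<sigma>)
    show ?thesis
      using integrable_normal_moment[OF 2(1), of 0 k]
      by (subst distributed_integrable[OF 2(2), symmetric]) auto
  qed
qed

lemma centered_gaussian_even_moment:
  assumes "gaussian_rv M X" and "expectation X = 0"
  shows "expectation (\<lambda>\<omega>. X \<omega> ^ (2 * m))
       = fact (2 * m) / (2 ^ m * fact m) * expectation (\<lambda>\<omega>. (X \<omega>)\<^sup>2) ^ m"
proof -
  have [measurable]: "X \<in> borel_measurable M" using assms by (simp add: gaussian_rv_def)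
  show ?thesis
  proof (cases rule: gaussian_rv_centered_cases[OF assms])
    case 1
    have *: "expectation (\<lambda>\<omega>. X \<omega> ^ k) = 0 ^ k" for k
    proof -
      have "expectation (\<lambda>\<omega>. X \<omega> ^ k) = expectation (\<lambda>\<omega>. 0 ^ k)"
        using 1 by (intro integral_cong_AE) auto
      then show ?thesis by (simp add: prob_space)
    qed
    show ?thesis unfolding * by (cases m) simp_all
  next
    case (2 \<sigma>)
    have *: "expectation (\<lambda>\<omega>. X \<omega> ^ (2 * m)) = fact (2 * m) / ((2 / \<sigma>\<^sup>2) ^ m * fact m)" for m
      using integral_normal_moment_even[OF 2(1), of 0 m]
      by (subst distributed_integral[OF 2(2), symmetric]) auto
    have "expectation (\<lambda>\<omega>. (X \<omega>)\<^sup>2) = \<sigma>\<^sup>2"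
      using *[of 1, unfolded mult_1_right] 2(1) by (simp add: field_simps)
    then show ?thesis
      using 2(1) by (simp add: * power_divide)
  qed
qed

lemma centered_gaussian_cdf:
  assumes "gaussian_rv M X" and "expectation X = 0"
    and "expectation (\<lambda>\<omega>. (X \<omega>)\<^sup>2) = s\<^sup>2" and "0 < s"
  shows "prob {\<omega> \<in> space M. X \<omega> / s \<le> x} = Phi x"
proof (cases rule: gaussian_rv_centered_cases[OF assms(1,2)])
  case 1
  have [measurable]: "X \<in> borel_measurable M" using assms by (simp add: gaussian_rv_def)
  have "expectation (\<lambda>\<omega>. (X \<omega>)\<^sup>2) = 0"
    using 1 by (subst integral_cong_AE[where g = "\<lambda>_. 0"]) auto
  then show ?thesis using assms by simp
next
  case (2 \<sigma>)
  have [measurable]: "X \<in> borel_measurable M" using assms by (simp add: gaussian_rv_def)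
  have "expectation (\<lambda>\<omega>. (X \<omega>)\<^sup>2) = \<sigma>\<^sup>2"
    using integral_normal_moment_even[OF 2(1), of 0 1]
    by (subst distributed_integral[OF 2(2), symmetric]) auto
  then have "\<sigma> = s" using assms 2(1) by (simp add: power2_eq_iff_nonneg)
  then have D: "distributed M lborel (\<lambda>\<omega>. X \<omega> / s) std_normal_density"
    using normal_standard_normal_convert[OF 2(1), of X 0] 2(2) by simp
  have "Phi x = measure (distr M lborel (\<lambda>\<omega>. X \<omega> / s)) {..x}"
    using distributed_distr_eq_density[OF D] by (simp add: cdf_def)
  also have "\<dots> = prob ((\<lambda>\<omega>. X \<omega> / s) -` {..x} \<inter> space M)"
    by (intro measure_distr) auto
  also have "(\<lambda>\<omega>. X \<omega> / s) -` {..x} \<inter> space M = {\<omega> \<in> space M. X \<omega> / s \<le> x}" by auto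
  finally show ?thesis by simp
qed

lemma fBM_gaussian:
  assumes "fractional_BM M H X" and "0 \<le> t"
  shows "gaussian_rv M (X t)" and "expectation (X t) = 0"
    and "expectation (\<lambda>\<omega>. (X t \<omega>)\<^sup>2) = t powr (2 * H)"
proof -
  have "gaussian_rv M (\<lambda>\<omega>. \<Sum>u\<in>{t}. 1 * X u \<omega>)"
    using assms unfolding fractional_BM_def gaussian_process_def
    by (elim conjE allE[of _ "{t}"] allE[of _ "\<lambda>_. 1"]) auto
  then show "gaussian_rv M (X t)" by simp
  show "expectation (X t) = 0" using assms by (simp add: fractional_BM_def)
  show "expectation (\<lambda>\<omega>. (X t \<omega>)\<^sup>2) = t powr (2 * H)"
    using assms unfolding fractional_BM_def power2_eq_square
    by (elim conjE allE[of _ t] impE) auto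
qed

text \<open>
  The variance comes from the covariance by polarization, which involves only squares of Gaussian
  variables and so raises no integrability question for the product.
\<close>

lemma fBM_increment_gaussian:
  assumes X: "fractional_BM M H X" and st: "0 \<le> s" "0 \<le> t"
  shows "gaussian_rv M (\<lambda>\<omega>. X t \<omega> - X s \<omega>)" and "expectation (\<lambda>\<omega>. X t \<omega> - X s \<omega>) = 0"
    and "expectation (\<lambda>\<omega>. (X t \<omega> - X s \<omega>)\<^sup>2) = \<bar>t - s\<bar> powr (2 * H)"
proof -
  note gt = fBM_gaussian[OF X st(2)] and gs = fBM_gaussian[OF X st(1)]
  show G: "gaussian_rv M (\<lambda>\<omega>. X t \<omega> - X s \<omega>)"
  proof -
    have "gaussian_rv M (\<lambda>\<omega>. \<Sum>u\<in>{s,t}. ((if u = t then 1 else 0) - (if u = s then 1 else 0)) * X u \<omega>)"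
      using X st unfolding fractional_BM_def gaussian_process_def
      by (elim conjE allE[of _ "{s,t}"]
            allE[of _ "\<lambda>u. (if u = t then 1 else 0) - (if u = s then 1 else 0)"]) auto
    then show ?thesis by (cases "s = t") (simp_all add: algebra_simps)
  qed
  show E: "expectation (\<lambda>\<omega>. X t \<omega> - X s \<omega>) = 0"
    using centered_gaussian_integrable_power[OF gt(1,2), of 1]
      centered_gaussian_integrable_power[OF gs(1,2), of 1] gt(2) gs(2)
    by (simp add: Bochner_Integration.integral_diff)
  let ?V = "expectation (\<lambda>\<omega>. (X t \<omega> - X s \<omega>)\<^sup>2)"
  have "expectation (\<lambda>\<omega>. X s \<omega> * X t \<omega>)
      = expectation (\<lambda>\<omega>. ((X s \<omega>)\<^sup>2 + (X t \<omega>)\<^sup>2 - (X t \<omega> - X s \<omega>)\<^sup>2) / 2)"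
    by (intro Bochner_Integration.integral_cong refl) (simp add: power2_eq_square algebra_simps)
  also have "\<dots> = (s powr (2 * H) + t powr (2 * H) - ?V) / 2"
    using centered_gaussian_integrable_power[OF gt(1,2), of 2]
      centered_gaussian_integrable_power[OF gs(1,2), of 2]
      centered_gaussian_integrable_power[OF G E, of 2]
    by (simp add: gt gs)
  finally show "?V = \<bar>t - s\<bar> powr (2 * H)"
    using X st by (simp add: fractional_BM_def abs_minus_commute)
qed

lemma fBM_measurable:
  assumes "fractional_BM M H X" and "0 \<le> t"
  shows "X t \<in> borel_measurable M"
  using fBM_gaussian(1)[OF assms] by (simp add: gaussian_rv_def)

text \<open>
  Markov's inequality for an even moment. The power \<open>m\<close> is free, so the bound beats any
  polynomial number of increments.
\<close>

lemma fBM_increment_tail: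
  assumes X: "fractional_BM M H X" and st: "0 \<le> s" "0 \<le> t" and u: "0 < u"
  shows "prob {\<omega> \<in> space M. u \<le> \<bar>X t \<omega> - X s \<omega>\<bar>}
       \<le> fact (2 * m) / (2 ^ m * fact m) * (\<bar>t - s\<bar> powr (2 * H) / u\<^sup>2) ^ m"
proof -
  note g = fBM_increment_gaussian[OF X st]
  note [measurable] = fBM_measurable[OF X st(1)] fBM_measurable[OF X st(2)]
  have "prob {\<omega> \<in> space M. u \<le> \<bar>X t \<omega> - X s \<omega>\<bar>}
      \<le> prob {\<omega> \<in> space M. u ^ (2 * m) \<le> (X t \<omega> - X s \<omega>) ^ (2 * m)}"
  proof (intro finite_measure_mono Collect_mono impI conjI; (elim conjE)?)
    fix \<omega> assume "u \<le> \<bar>X t \<omega> - X s \<omega>\<bar>"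
    then have "u ^ (2 * m) \<le> \<bar>X t \<omega> - X s \<omega>\<bar> ^ (2 * m)" using u by (intro power_mono) auto
    then show "u ^ (2 * m) \<le> (X t \<omega> - X s \<omega>) ^ (2 * m)" by (simp add: power_even_abs)
  qed auto
  also have "\<dots> \<le> expectation (\<lambda>\<omega>. (X t \<omega> - X s \<omega>) ^ (2 * m)) / u ^ (2 * m)"
    using centered_gaussian_integrable_power[OF g(1,2), of "2 * m"] u
    by (intro integral_Markov_inequality_measure[where A = "space M"]) auto
  also have "\<dots> = fact (2 * m) / (2 ^ m * fact m) * (\<bar>t - s\<bar> powr (2 * H) / u\<^sup>2) ^ m"
    unfolding centered_gaussian_even_moment[OF g(1,2)] g(3)
    by (simp add: power_divide power_mult)
  finally show ?thesis .
qed

end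

section \<open>Hoelder bounds for a growing sample\<close>

context prob_space
begin

definition large_increment :: "(nat \<Rightarrow> real \<Rightarrow> 'a \<Rightarrow> real) \<Rightarrow> real \<Rightarrow> real \<Rightarrow> nat \<Rightarrow> nat \<Rightarrow> nat \<Rightarrow> nat \<Rightarrow> 'a set" where
  "large_increment B H T n k j i = {\<omega> \<in> space M. real n * 2 powr (- (H / 2) * real k)
     \<le> \<bar>B j (T * real (Suc i) / 2 ^ k) \<omega> - B j (T * real i / 2 ^ k) \<omega>\<bar>}"

lemma large_increment_event:
  assumes fBM: "\<And>j. fractional_BM M H (B j)" and T: "0 < T"
  shows "large_increment B H T n k j i \<in> events"
proof -
  have [measurable]: "B j (T * real i / 2 ^ k) \<in> borel_measurable M" for i
    using fBM_measurable[OF fBM] T by simp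
  show ?thesis unfolding large_increment_def by measurable
qed

text \<open>
  The moment order \<open>m\<close> is chosen with \<open>m * H \<ge> 2\<close>. A threshold at half the Hurst
  exponent leaves \<open>2 powr (- k * m * H) \<le> 4 powr (- k)\<close> for a single increment, which pays for the
  \<open>2 ^ k\<close> increments of level \<open>k\<close>; and \<open>m \<ge> 2\<close> leaves a summable power of
  \<open>n\<close> after the union over the sample.
\<close>

lemma fBM_dyadic_increments_tail:
  fixes B :: "nat \<Rightarrow> real \<Rightarrow> 'a \<Rightarrow> real"
  assumes fBM: "\<And>j. fractional_BM M H (B j)" and H: "0 < H" and T: "0 < T"
  shows "\<exists>K\<ge>0. \<forall>n k. 0 < n \<longrightarrow>
     prob (\<Union>j\<in>{1..n}. \<Union>i<2 ^ k. large_increment B H T n k j i)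
     \<le> K / real n ^ 3 * (1/2) ^ k"
proof -
  \<comment> \<open>The moment order, large enough for both requirements \<open>mH\<close> and \<open>m2\<close>.\<close>
  define m where "m = nat \<lceil>2 / H\<rceil> + 2"
  have mH: "2 \<le> real m * H"
  proof -
    have "2 / H \<le> real m" unfolding m_def by linarith
    then show ?thesis using H by (simp add: field_simps)
  qed
  have m2: "2 \<le> m" by (simp add: m_def)
  define K :: real where "K = fact (2 * m) / (2 ^ m * fact m) * (T powr (2 * H)) ^ m"
  let ?E = "large_increment B H T"
  note meas = large_increment_event[OF fBM T]
  have single: "prob (?E n k j i) \<le> K / real n ^ 4 * (1/4) ^ k" if "0 < n" for n k j i
  proof -
    let ?u = "real n * 2 powr (- (H / 2) * real k)"
    have st: "0 \<le> T * real i / 2 ^ k" "0 \<le> T * real (Suc i) / 2 ^ k" using T by auto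
    have diff: "\<bar>T * real (Suc i) / 2 ^ k - T * real i / 2 ^ k\<bar> = T / 2 ^ k"
      using T by (simp add: diff_divide_distrib[symmetric] algebra_simps)
    have pw: "(2::real) ^ k = 2 powr (real k)" by (simp add: powr_realpow)
    have u2: "?u\<^sup>2 = real n ^ 2 * 2 powr (- H * real k)"
      by (simp add: power2_eq_square powr_add[symmetric] mult_ac)
    have "(T / 2 ^ k) powr (2 * H) / ?u\<^sup>2
        = T powr (2 * H) * (2 powr (- 2 * H * real k) * 2 powr (H * real k)) / real n ^ 2"
      unfolding u2 pw using T that by (simp add: powr_divide powr_powr powr_minus field_simps)
    also have "2 powr (- 2 * H * real k) * 2 powr (H * real k) = 2 powr (- H * real k)"
      by (simp add: powr_add[symmetric] algebra_simps)
    finally have q: "(T / 2 ^ k) powr (2 * H) / ?u\<^sup>2 = T powr (2 * H) * 2 powr (- H * real k) / real n ^ 2" .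
    have "prob (?E n k j i) \<le> fact (2 * m) / (2 ^ m * fact m)
        * (\<bar>T * real (Suc i) / 2 ^ k - T * real i / 2 ^ k\<bar> powr (2 * H) / ?u\<^sup>2) ^ m"
      unfolding large_increment_def using that by (intro fBM_increment_tail[OF fBM st]) simp_all
    also have "\<dots> = K * ((2 powr (- H * real k)) ^ m / (real n ^ 2) ^ m)"
      unfolding diff q by (simp add: K_def power_divide power_mult_distrib)
    also have "\<dots> \<le> K * ((1/4) ^ k / real n ^ 4)"
    proof (intro mult_left_mono frac_le)
      have "(2 powr (- H * real k)) ^ m = 2 powr (- (real m * H) * real k)"
        using powr_realpow[of "2 powr (- H * real k)" m] by (simp only: powr_powr) (simp add: mult_ac)
      also have "\<dots> \<le> 2 powr (- 2 * real k)"
        using mH by (intro powr_mono mult_right_mono) auto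
      also have "\<dots> = (2 powr (-2)) powr real k" by (simp add: powr_powr)
      also have "\<dots> = (1/4) ^ k" by (subst powr_realpow) (auto simp: powr_minus)
      finally show "(2 powr (- H * real k)) ^ m \<le> (1/4) ^ k" .
      show "real n ^ 4 \<le> (real n ^ 2) ^ m"
        unfolding power_mult[symmetric] using that m2 by (intro power_increasing) auto
    qed (use that in \<open>auto simp: K_def\<close>)
    finally show ?thesis by simp
  qed
  have "prob (\<Union>j\<in>{1..n}. \<Union>i<2 ^ k. ?E n k j i) \<le> K / real n ^ 3 * (1/2) ^ k" if "0 < n" for n k
  proof -
    have "prob (\<Union>j\<in>{1..n}. \<Union>i<2 ^ k. ?E n k j i) \<le> (\<Sum>j\<in>{1..n}. prob (\<Union>i<2 ^ k. ?E n k j i))"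
      by (intro measure_UNION_le sets.finite_UN meas) auto
    also have "\<dots> \<le> (\<Sum>j\<in>{1..n}. \<Sum>i<2 ^ k. prob (?E n k j i))"
      by (intro sum_mono measure_UNION_le meas) auto
    also have "\<dots> \<le> (\<Sum>j\<in>{1..n}. \<Sum>i<(2::nat) ^ k. K / real n ^ 4 * (1/4) ^ k)"
      by (intro sum_mono single that)
    also have "\<dots> = K / real n ^ 3 * (2 ^ k * (1/4) ^ k)"
      using that by (simp add: field_simps power3_eq_cube power4_eq_xxxx)
    also have "(2::real) ^ k * (1/4) ^ k = (1/2) ^ k"
      by (simp add: power_mult_distrib[symmetric])
    finally show ?thesis .
  qed
  moreover have "0 \<le> K" by (simp add: K_def)
  ultimately show ?thesis by blast
qed

text \<open>
  The modulus of continuity of a single path has a random constant, and the maximum of \<open>n\<close> such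
  constants must be controlled. Giving up half of the Hoelder exponent and allowing the constant to grow like
  \<open>n\<close> is harmless, because the estimate is used on a mesh that is a large negative power of
  \<open>n\<close>.
\<close>

lemma fBM_Holder_AE:
  fixes B :: "nat \<Rightarrow> real \<Rightarrow> 'a \<Rightarrow> real"
  assumes fBM: "\<And>j. fractional_BM M H (B j)" and H: "0 < H" and T: "0 < T"
  shows "\<exists>C>0. AE \<omega> in M. \<forall>\<^sub>F n in sequentially. \<forall>j\<in>{1..n}. \<forall>s\<in>{0..T}. \<forall>t\<in>{0..T}.
           \<bar>B j t \<omega> - B j s \<omega>\<bar> \<le> C * real n * \<bar>t - s\<bar> powr (H / 2)"
proof -
  define \<beta> where "\<beta> = H / 2"
  have \<beta>: "0 < \<beta>" using H by (simp add: \<beta>_def)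
  define C where "C = chaining_const \<beta> / T powr \<beta>"
  have C: "0 < C" using chaining_const_pos[OF \<beta>] T by (simp add: C_def)
  let ?E = "large_increment B H T"
  define bad where "bad n = (\<Union>k. \<Union>j\<in>{1..n}. \<Union>i<2 ^ k. ?E n k j i)" for n
  note meas = large_increment_event[OF fBM T]
  have bad_meas: "bad n \<in> events" for n
    unfolding bad_def by (intro sets.countable_UN image_subsetI sets.finite_UN meas) auto
  obtain K where K: "0 \<le> K \<and> (\<forall>n k. 0 < n \<longrightarrow>
      prob (\<Union>j\<in>{1..n}. \<Union>i<2 ^ k. ?E n k j i) \<le> K / real n ^ 3 * (1/2) ^ k)"
    using fBM_dyadic_increments_tail[OF fBM H T] by (rule exE)
  have bad_prob: "prob (bad n) \<le> K * 2 * inverse (real n ^ 3)" for n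
  proof (cases "n = 0")
    case True then show ?thesis by (simp add: bad_def)
  next
    case False
    let ?U = "\<lambda>k. \<Union>j\<in>{1..n}. \<Union>i<2 ^ k. ?E n k j i"
    have geo: "(\<lambda>k. K / real n ^ 3 * (1/2) ^ k) sums (K / real n ^ 3 * 2)"
      using sums_mult[OF geometric_sums[of "1/2::real"], of "K / real n ^ 3"] by simp
    have le: "prob (?U k) \<le> K / real n ^ 3 * (1/2) ^ k" for k
      using K False by simp
    have summ: "summable (\<lambda>k. prob (?U k))"
      using le by (intro summable_comparison_test'[OF sums_summable[OF geo]]) simp
    have "prob (bad n) \<le> (\<Sum>k. prob (?U k))"
      unfolding bad_def
      by (intro finite_measure_subadditive_countably summ image_subsetI sets.finite_UN meas) auto
    also have "\<dots> \<le> (\<Sum>k. K / real n ^ 3 * (1/2) ^ k)"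
      by (intro suminf_le le summ sums_summable[OF geo])
    also have "\<dots> = K * 2 * inverse (real n ^ 3)"
      using sums_unique[OF geo] by (simp add: field_simps)
    finally show ?thesis .
  qed
  have "AE \<omega> in M. \<forall>\<^sub>F n in sequentially. \<omega> \<in> space M - bad n"
  proof (rule borel_cantelli_AE1[OF bad_meas])
    show "summable (\<lambda>n. prob (bad n))"
    proof (rule summable_comparison_test')
      show "summable (\<lambda>n. K * 2 * inverse (real n ^ 3))"
        by (intro summable_mult inverse_power_summable) simp
      show "norm (prob (bad n)) \<le> K * 2 * inverse (real n ^ 3)" for n
        using bad_prob[of n] by simp
    qed
  qed (simp add: emeasure_eq_measure)
  then have "AE \<omega> in M. \<forall>\<^sub>F n in sequentially. \<forall>j\<in>{1..n}. \<forall>s\<in>{0..T}. \<forall>t\<in>{0..T}.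
           \<bar>B j t \<omega> - B j s \<omega>\<bar> \<le> C * real n * \<bar>t - s\<bar> powr (H / 2)"
  proof (rule AE_mp, intro AE_I2 impI)
    fix \<omega> assume \<omega>: "\<omega> \<in> space M"
    assume "\<forall>\<^sub>F n in sequentially. \<omega> \<in> space M - bad n"
    then show "\<forall>\<^sub>F n in sequentially. \<forall>j\<in>{1..n}. \<forall>s\<in>{0..T}. \<forall>t\<in>{0..T}.
           \<bar>B j t \<omega> - B j s \<omega>\<bar> \<le> C * real n * \<bar>t - s\<bar> powr (H / 2)"
    proof (eventually_elim, intro ballI)
      fix n j s t
      assume good: "\<omega> \<in> space M - bad n" and j: "j \<in> {1..n}" and st: "s \<in> {0..T}" "t \<in> {0..T}"
      define g where "g x = B j (T * x) \<omega>" for x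
      have cont: "continuous_on {0..1} g"
      proof -
        have "continuous_on {0..} (\<lambda>t. B j t \<omega>)" using fBM \<omega> by (auto simp: fractional_BM_def)
        then show ?thesis unfolding g_def
          by (rule continuous_on_compose2) (use T in \<open>auto intro!: continuous_intros\<close>)
      qed
      have incr: "\<bar>g (real (Suc i) / 2 ^ k) - g (real i / 2 ^ k)\<bar> \<le> real n * 2 powr (- \<beta> * real k)"
        if "i < 2 ^ k" for i k
      proof -
        have "\<omega> \<notin> ?E n k j i" using good j that by (auto simp: bad_def)
        then show ?thesis using \<omega> by (simp add: g_def \<beta>_def not_le large_increment_def)
      qed
      have "\<bar>g (t / T) - g (s / T)\<bar> \<le> chaining_const \<beta> * real n * \<bar>t / T - s / T\<bar> powr \<beta>"
        using st T by (intro dyadic_increments_imp_Holder[OF cont _ \<beta> incr]) auto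
      also have "\<bar>t / T - s / T\<bar> = \<bar>t - s\<bar> / T"
        using T by (simp add: diff_divide_distrib[symmetric] abs_divide)
      also have "chaining_const \<beta> * real n * (\<bar>t - s\<bar> / T) powr \<beta> = C * real n * \<bar>t - s\<bar> powr \<beta>"
        using T by (simp add: C_def powr_divide)
      finally show "\<bar>B j t \<omega> - B j s \<omega>\<bar> \<le> C * real n * \<bar>t - s\<bar> powr (H / 2)"
        using T by (simp add: g_def \<beta>_def)
    qed
  qed
  then show ?thesis using C by blast
qed

end

section \<open>The empirical process on a polynomial grid\<close>

definition emp_dev :: "(nat \<Rightarrow> 'a \<Rightarrow> real) \<Rightarrow> nat \<Rightarrow> 'a \<Rightarrow> real \<Rightarrow> real" where
  "emp_dev X n \<omega> x = (\<Sum>j=1..n. indicator {..x} (X j \<omega>)) / real n - Phi x"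

lemma emp_dev_measurable:
  assumes "\<And>j. X j \<in> borel_measurable M"
  shows "(\<lambda>\<omega>. emp_dev X n \<omega> x) \<in> borel_measurable M"
  unfolding emp_dev_def using assms by measurable

lemma emp_dev_events:
  assumes "\<And>j. X j \<in> borel_measurable M"
  shows "{\<omega> \<in> space M. c \<le> \<bar>emp_dev X n \<omega> x\<bar>} \<in> sets M"
    and "{\<omega> \<in> space M. c \<le> \<bar>emp_dev X n \<omega> x - emp_dev X n \<omega> y\<bar>} \<in> sets M"
proof -
  have [measurable]: "(\<lambda>\<omega>. emp_dev X n \<omega> x) \<in> borel_measurable M" for x
    using assms by (rule emp_dev_measurable)
  show "{\<omega> \<in> space M. c \<le> \<bar>emp_dev X n \<omega> x\<bar>} \<in> sets M"
    and "{\<omega> \<in> space M. c \<le> \<bar>emp_dev X n \<omega> x - emp_dev X n \<omega> y\<bar>} \<in> sets M"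
    by measurable
qed

lemma powr_square: "((x::real) powr a)\<^sup>2 = x powr (2 * a)"
  by (simp add: power2_eq_square powr_add[symmetric])

lemma powr_nonpos_le_one: "1 \<le> x \<Longrightarrow> a \<le> 0 \<Longrightarrow> x powr a \<le> (1::real)"
  using powr_mono[of a 0 x] by simp

text \<open>
  The grid consists of the times \<open>T * i / n ^ K\<close> and the levels \<open>l / n\<close> with
  \<open>\<bar>l\<bar> \<le> n\<^sup>2\<close>, which eventually cover every bounded range. Time zero is left out because
  all paths vanish there.
\<close>

definition grid_regular :: "(real \<Rightarrow> nat \<Rightarrow> 'a \<Rightarrow> real) \<Rightarrow> real \<Rightarrow> nat \<Rightarrow> real \<Rightarrow> nat \<Rightarrow> 'a \<Rightarrow> bool" where
  "grid_regular X T K W n \<omega> \<longleftrightarrow>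
     (\<forall>i\<in>{1..n ^ K}. \<forall>l\<in>{- (int n)\<^sup>2..(int n)\<^sup>2}. \<forall>m\<in>{- (int n)\<^sup>2..(int n)\<^sup>2}.
        let D = emp_dev (X (T * real i / real (n ^ K))) n \<omega> in
        \<bar>D (of_int l / real n)\<bar> \<le> real n powr (- 11/24) \<and>
        (\<bar>of_int l / real n - of_int m / real n\<bar> \<le> W * real n powr (- 11/24) \<longrightarrow>
         \<bar>D (of_int l / real n) - D (of_int m / real n)\<bar> \<le> real n powr (- 2/3)))"

context prob_space
begin

text \<open>
  The standard Chernoff bound with parameter \<open>n\<close> to the power \<open>- 1/2\<close>. The level
  \<open>- 11/24\<close> exceeds \<open>- 1/2\<close> by the margin \<open>1/24\<close> that appears in the exponential.
\<close>

lemma emp_dev_tail: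
  assumes indep: "indep_vars (\<lambda>_. borel) X {1..n}"
    and cdf: "\<And>j. prob {\<omega> \<in> space M. X j \<omega> \<le> x} = Phi x"
    and n: "0 < n"
  shows "prob {\<omega> \<in> space M. \<bar>emp_dev X n \<omega> x\<bar> \<ge> real n powr (- 11/24)}
       \<le> 2 * exp (1 - real n powr (1/24))"
proof -
  interpret N: real_distribution std_normal_distribution by (rule real_dist_normal_dist)
  let ?S = "\<lambda>\<omega>. (\<Sum>j\<in>{1..n}. indicator {..x} (X j \<omega>)) - real (card {1..n}) * Phi x"
  have n13: "real n * real n powr (- 11/24) = real n powr (13/24)"
    using n by (simp add: powr_mult_base)
  have eq: "{\<omega> \<in> space M. \<bar>emp_dev X n \<omega> x\<bar> \<ge> real n powr (- 11/24)}
      = {\<omega> \<in> space M. \<bar>?S \<omega>\<bar> \<ge> real n powr (13/24)}"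
  proof -
    have "?S \<omega> = real n * emp_dev X n \<omega> x" for \<omega>
      using n by (simp add: emp_dev_def field_simps)
    then have "\<bar>?S \<omega>\<bar> = real n * \<bar>emp_dev X n \<omega> x\<bar>" for \<omega> by (simp add: abs_mult)
    then show ?thesis using n by (simp only: n13[symmetric] mult_le_cancel_left_pos of_nat_0_less_iff)
  qed
  have "prob {\<omega> \<in> space M. \<bar>?S \<omega>\<bar> \<ge> real n powr (13/24)}
      \<le> 2 * exp (real (card {1..n}) * Phi x * (real n powr (- 1/2))\<^sup>2
                              - real n powr (- 1/2) * real n powr (13/24))"
    using n by (intro Chernoff_indicator indep) (auto simp: cdf powr_nonpos_le_one)
  also have "\<dots> \<le> 2 * exp (1 - real n powr (1/24))"
  proof -
    have "real n * Phi x * real n powr (-1) \<le> 1"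
      using n N.cdf_bounded_prob[of x] by (simp add: powr_minus field_simps)
    then show ?thesis by (simp add: powr_square powr_add[symmetric])
  qed
  finally show ?thesis unfolding eq .
qed

text \<open>
  An interval of length \<open>n\<close> to the power \<open>- 11/24\<close> contains about
  \<open>n\<close> to the power \<open>13/24\<close> points, whose number fluctuates by \<open>n\<close> to the power
  \<open>13/48 < 1/3\<close>. The parameter \<open>n powr (- 7/24)\<close> makes the quadratic term of the Chernoff bound
  at most \<open>W\<close> and the linear term \<open>n powr (1/24)\<close>.
\<close>

lemma emp_dev_increment_tail:
  assumes indep: "indep_vars (\<lambda>_. borel) X {1..n}"
    and cdf: "\<And>j x. prob {\<omega> \<in> space M. X j \<omega> \<le> x} = Phi x"
    and meas [measurable]: "\<And>j. X j \<in> borel_measurable M"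
    and n: "0 < n" and xy: "\<bar>x - y\<bar> \<le> W * real n powr (- 11/24)"
  shows "prob {\<omega> \<in> space M. \<bar>emp_dev X n \<omega> x - emp_dev X n \<omega> y\<bar> \<ge> real n powr (- 2/3)}
       \<le> 2 * exp (W - real n powr (1/24))"
proof -
  have main: "prob {\<omega> \<in> space M. \<bar>emp_dev X n \<omega> y - emp_dev X n \<omega> x\<bar> \<ge> real n powr (- 2/3)}
       \<le> 2 * exp (W - real n powr (1/24))"
    if "x \<le> y" and xy: "y - x \<le> W * real n powr (- 11/24)" for x y
  proof -
    let ?p = "Phi y - Phi x"
    let ?S = "\<lambda>\<omega>. (\<Sum>j\<in>{1..n}. indicator {x<..y} (X j \<omega>)) - real (card {1..n}) * ?p"
    have n13: "real n * real n powr (- 2/3) = real n powr (1/3)"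
      using n by (simp add: powr_mult_base)
    have p: "prob {\<omega> \<in> space M. X j \<omega> \<in> {x<..y}} = ?p" for j
    proof -
      have "{\<omega> \<in> space M. X j \<omega> \<in> {x<..y}} = {\<omega> \<in> space M. X j \<omega> \<le> y} - {\<omega> \<in> space M. X j \<omega> \<le> x}"
        by auto
      then show ?thesis using \<open>x \<le> y\<close>
        by (simp add: finite_measure_Diff cdf subset_eq)
    qed
    have eq: "{\<omega> \<in> space M. \<bar>emp_dev X n \<omega> y - emp_dev X n \<omega> x\<bar> \<ge> real n powr (- 2/3)}
        = {\<omega> \<in> space M. \<bar>?S \<omega>\<bar> \<ge> real n powr (1/3)}"
    proof -
      have "indicator {x<..y} v = (indicator {..y} v - indicator {..x} v :: real)" for v
        using \<open>x \<le> y\<close> by (auto simp: indicator_def)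
      then have "(\<Sum>j\<in>{1..n}. indicator {x<..y} (X j \<omega>) :: real)
          = (\<Sum>j\<in>{1..n}. indicator {..y} (X j \<omega>)) - (\<Sum>j\<in>{1..n}. indicator {..x} (X j \<omega>))" for \<omega>
        by (simp only: sum_subtractf)
      then have "?S \<omega> = real n * (emp_dev X n \<omega> y - emp_dev X n \<omega> x)" for \<omega>
        using n by (simp add: emp_dev_def right_diff_distrib)
      then have "\<bar>?S \<omega>\<bar> = real n * \<bar>emp_dev X n \<omega> y - emp_dev X n \<omega> x\<bar>" for \<omega> by (simp add: abs_mult)
      then show ?thesis using n by (simp only: n13[symmetric] mult_le_cancel_left_pos of_nat_0_less_iff)
    qed
    have "prob {\<omega> \<in> space M. \<bar>?S \<omega>\<bar> \<ge> real n powr (1/3)}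
        \<le> 2 * exp (real (card {1..n}) * ?p * (real n powr (- 7/24))\<^sup>2
                                - real n powr (- 7/24) * real n powr (1/3))"
      using n by (intro Chernoff_indicator indep p) (auto simp: powr_nonpos_le_one)
    also have "\<dots> \<le> 2 * exp (W - real n powr (1/24))"
    proof -
      have W: "0 \<le> W"
      proof (rule ccontr)
        assume "\<not> 0 \<le> W"
        then have "W * real n powr (- 11/24) < 0" using n by (intro mult_neg_pos) auto
        then show False using that by linarith
      qed
      have "?p \<le> W * real n powr (- 11/24)"
        using Phi_lipschitz[of y x] xy \<open>x \<le> y\<close> by linarith
      then have "real n * ?p * real n powr (- 7/12) \<le> real n * (W * real n powr (- 11/24)) * real n powr (- 7/12)"
        by (intro mult_right_mono mult_left_mono) auto
      also have "\<dots> = W * (real n powr 1 * real n powr (- 11/24) * real n powr (- 7/12))"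
        using n by simp
      also have "\<dots> = W * real n powr (- 1/24)"
        by (simp only: powr_add[symmetric]) simp
      also have "\<dots> \<le> W * 1" using W n by (intro mult_left_mono) (auto simp: powr_nonpos_le_one)
      finally show ?thesis by (simp add: powr_square powr_add[symmetric])
    qed
    finally show ?thesis unfolding eq .
  qed
  show ?thesis
  proof (cases "x \<le> y")
    case True
    then show ?thesis using main[of x y] xy by (simp add: abs_minus_commute)
  next
    case False
    then show ?thesis using main[of y x] xy by simp
  qed
qed

text \<open>
  The factor in front counts the grid triples in \<open>grid_regular\<close>: \<open>n ^ K\<close> times
  and a pair of levels from \<open>2 * n\<^sup>2 + 1\<close> each.
\<close>

lemma summable_poly_exp:
  "summable (\<lambda>n. real (n ^ K * (2 * n\<^sup>2 + 1)\<^sup>2) * (c * exp (V - real n powr (1/24))))"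
proof -
  let ?f = "\<lambda>n. real (n ^ K * (2 * n\<^sup>2 + 1)\<^sup>2) * (c * exp (V - real n powr (1/24)))"
  define L where "L = 24 * (K + 6)"
  have "((\<lambda>x::real. x ^ L / exp x) \<longlongrightarrow> 0) at_top" by (rule tendsto_power_div_exp_0)
  moreover have "filterlim (\<lambda>n. real n powr (1/24)) at_top sequentially"
    by real_asymp
  ultimately have lim: "(\<lambda>n. (real n powr (1/24)) ^ L / exp (real n powr (1/24))) \<longlonglongrightarrow> 0"
    by (rule filterlim_compose)
  have "\<forall>\<^sub>F n in sequentially. norm (?f n) \<le> (9 * \<bar>c\<bar> * exp V) * inverse (real n ^ 2)"
    using order_tendstoD(2)[OF lim zero_less_one] eventually_gt_at_top[of 0]
  proof eventually_elim
    case (elim n)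
    have "(real n powr (1/24)) ^ L = real n ^ (K + 6)"
    proof -
      have "(real n powr (1/24)) ^ L = (real n powr (1/24)) powr real L"
        using elim(2) by (simp add: powr_realpow)
      also have "\<dots> = real n powr real (K + 6)" by (simp add: powr_powr L_def add_divide_distrib)
      also have "\<dots> = real n ^ (K + 6)" using elim(2) by (simp only: powr_realpow of_nat_0_less_iff)
      finally show ?thesis .
    qed
    then have 1: "real n ^ (K + 6) * exp (- (real n powr (1/24))) \<le> 1"
      using elim(1) by (simp add: exp_minus field_simps)
    have "real n ^ K * (2 * (real n)\<^sup>2 + 1)\<^sup>2 \<le> real n ^ K * (3 * (real n)\<^sup>2)\<^sup>2"
      using elim(2) by (intro mult_left_mono power_mono) auto
    also have "\<dots> = 9 * real n ^ (K + 6) * inverse (real n ^ 2)"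
      using elim(2) by (simp add: power_add field_simps eval_nat_numeral)
    finally have 2: "real n ^ K * (2 * (real n)\<^sup>2 + 1)\<^sup>2 \<le> 9 * real n ^ (K + 6) * inverse (real n ^ 2)" .
    have "norm (?f n) = (real n ^ K * (2 * (real n)\<^sup>2 + 1)\<^sup>2) * (\<bar>c\<bar> * exp V * exp (- (real n powr (1/24))))"
      by (simp add: abs_mult exp_diff exp_minus field_simps)
    also have "\<dots> \<le> 9 * real n ^ (K + 6) * inverse (real n ^ 2) * (\<bar>c\<bar> * exp V * exp (- (real n powr (1/24))))"
      by (intro mult_right_mono 2) auto
    also have "\<dots> = (9 * \<bar>c\<bar> * exp V) * inverse (real n ^ 2) * (real n ^ (K + 6) * exp (- (real n powr (1/24))))"
      by (simp only: mult_ac)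
    also have "\<dots> \<le> (9 * \<bar>c\<bar> * exp V) * inverse (real n ^ 2) * 1"
      by (intro mult_left_mono 1) auto
    finally show ?case by simp
  qed
  then show ?thesis
    by (rule summable_comparison_test_ev) (intro summable_mult inverse_power_summable, simp)
qed

lemma grid_regular_AE:
  assumes indep: "\<And>s. 0 < s \<Longrightarrow> indep_vars (\<lambda>_. borel) (X s) UNIV"
    and cdf: "\<And>s j x. 0 < s \<Longrightarrow> prob {\<omega> \<in> space M. X s j \<omega> \<le> x} = Phi x"
    and T: "0 < T"
  shows "AE \<omega> in M. \<forall>\<^sub>F n in sequentially. grid_regular X T K W n \<omega>"
proof -
  have meas [measurable]: "0 < s \<Longrightarrow> X s j \<in> borel_measurable M" for s j
    using indep[of s] by (auto simp: indep_vars_def)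
  define V where "V = max 1 W"
  define Bad where "Bad n s x y = {\<omega> \<in> space M. \<bar>emp_dev (X s) n \<omega> x\<bar> \<ge> real n powr (- 11/24)} \<union>
      (if \<bar>x - y\<bar> \<le> W * real n powr (- 11/24)
       then {\<omega> \<in> space M. \<bar>emp_dev (X s) n \<omega> x - emp_dev (X s) n \<omega> y\<bar> \<ge> real n powr (- 2/3)} else {})"
    for n s x y
  have Bad_meas: "Bad n s x y \<in> events" if "0 < s" for n s x y
    unfolding Bad_def using emp_dev_events[OF meas[OF that]] by (intro sets.Un) simp_all
  have Bad_prob: "prob (Bad n s x y) \<le> 4 * exp (V - real n powr (1/24))" if s: "0 < s" and n: "0 < n" for n s x y
  proof -
    note i = indep_vars_subset[OF indep[OF s] subset_UNIV[of "{1..n}"]]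
    have le: "2 * exp (1 - real n powr (1/24)) \<le> 2 * exp (V - real n powr (1/24))"
      "2 * exp (W - real n powr (1/24)) \<le> 2 * exp (V - real n powr (1/24))" by (auto simp: V_def)
    have 1: "prob {\<omega> \<in> space M. \<bar>emp_dev (X s) n \<omega> x\<bar> \<ge> real n powr (- 11/24)} \<le> 2 * exp (V - real n powr (1/24))"
      by (rule order_trans[OF emp_dev_tail[OF i cdf[OF s] n] le(1)])
    have 2: "prob (if \<bar>x - y\<bar> \<le> W * real n powr (- 11/24)
       then {\<omega> \<in> space M. \<bar>emp_dev (X s) n \<omega> x - emp_dev (X s) n \<omega> y\<bar> \<ge> real n powr (- 2/3)} else {})
       \<le> 2 * exp (V - real n powr (1/24))"
      using order_trans[OF emp_dev_increment_tail[OF i cdf[OF s] meas[OF s] n, of x y W] le(2)]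
      by (cases "\<bar>x - y\<bar> \<le> W * real n powr (- 11/24)") simp_all
    have "prob (Bad n s x y) \<le> prob {\<omega> \<in> space M. \<bar>emp_dev (X s) n \<omega> x\<bar> \<ge> real n powr (- 11/24)} +
        prob (if \<bar>x - y\<bar> \<le> W * real n powr (- 11/24)
       then {\<omega> \<in> space M. \<bar>emp_dev (X s) n \<omega> x - emp_dev (X s) n \<omega> y\<bar> \<ge> real n powr (- 2/3)} else {})"
      unfolding Bad_def using emp_dev_events[OF meas[OF s]] by (intro measure_Un_le) simp_all
    then show ?thesis using 1 2 by linarith
  qed
  define time where "time n i = T * real i / real (n ^ K)" for n i
  define Z where "Z n = {- (int n)\<^sup>2..(int n)\<^sup>2}" for n
  define bad where "bad n = (\<Union>(i,l,m)\<in>{1..n ^ K} \<times> Z n \<times> Z n.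
      Bad n (time n i) (of_int l / real n) (of_int m / real n))" for n
  have time_pos: "0 < time n i" if "0 < n" "i \<in> {1..n ^ K}" for n i
    using T that by (simp add: time_def)
  have "AE \<omega> in M. \<forall>\<^sub>F n in sequentially. \<omega> \<in> space M - bad (Suc n)"
  proof (rule borel_cantelli_AE1)
    have bad_meas: "bad n \<in> events" if "0 < n" for n
      unfolding bad_def using that by (auto intro!: sets.finite_UN Bad_meas time_pos simp: Z_def)
    then show "bad (Suc n) \<in> events" for n by simp
    have bound: "prob (bad n) \<le> real (n ^ K * (2 * n\<^sup>2 + 1)\<^sup>2) * (4 * exp (V - real n powr (1/24)))"
      if n: "0 < n" for n
    proof -
      let ?I = "{1..n ^ K} \<times> Z n \<times> Z n"
      have "card (Z n) = 2 * n\<^sup>2 + 1" by (simp add: Z_def nat_add_distrib nat_mult_distrib nat_power_eq)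
      then have card: "card ?I = n ^ K * (2 * n\<^sup>2 + 1)\<^sup>2"
        by (simp add: card_cartesian_product power2_eq_square)
      have "prob (bad n) \<le> (\<Sum>(i,l,m)\<in>?I. prob (Bad n (time n i) (of_int l / real n) (of_int m / real n)))"
        unfolding bad_def using n
        by (intro order.trans[OF measure_UNION_le])
           (auto intro!: Bad_meas time_pos sum_mono simp: Z_def)
      also have "\<dots> \<le> (\<Sum>(i,l,m)\<in>?I. 4 * exp (V - real n powr (1/24)))"
        using n by (intro sum_mono) (auto intro!: Bad_prob time_pos)
      also have "\<dots> = real (card ?I) * (4 * exp (V - real n powr (1/24)))"
        by (simp add: case_prod_beta)
      finally show ?thesis unfolding card .
    qed
    show "summable (\<lambda>n. prob (bad (Suc n)))"
    proof (rule summable_comparison_test')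
      show "summable (\<lambda>n. real (Suc n ^ K * (2 * (Suc n)\<^sup>2 + 1)\<^sup>2) * (4 * exp (V - real (Suc n) powr (1/24))))"
        using summable_poly_exp[of K 4 V] by (subst summable_Suc_iff)
      show "norm (prob (bad (Suc n)))
          \<le> real (Suc n ^ K * (2 * (Suc n)\<^sup>2 + 1)\<^sup>2) * (4 * exp (V - real (Suc n) powr (1/24)))" for n
        unfolding real_norm_def abs_of_nonneg[OF measure_nonneg] by (rule bound) simp
    qed
  qed (simp add: emeasure_eq_measure)
  moreover have good: "grid_regular X T K W n \<omega>" if \<omega>: "\<omega> \<in> space M - bad n" for n \<omega>
    unfolding grid_regular_def Let_def Z_def[symmetric]
  proof (intro ballI)
    fix i l m assume "i \<in> {1..n ^ K}" "l \<in> Z n" "m \<in> Z n"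
    then have "\<omega> \<notin> Bad n (time n i) (of_int l / real n) (of_int m / real n)"
      using \<omega> by (auto simp: bad_def)
    then show "\<bar>emp_dev (X (T * real i / real (n ^ K))) n \<omega> (of_int l / real n)\<bar> \<le> real n powr (- 11/24) \<and>
      (\<bar>of_int l / real n - of_int m / real n\<bar> \<le> W * real n powr (- 11/24) \<longrightarrow>
       \<bar>emp_dev (X (T * real i / real (n ^ K))) n \<omega> (of_int l / real n)
        - emp_dev (X (T * real i / real (n ^ K))) n \<omega> (of_int m / real n)\<bar> \<le> real n powr (- 2/3))"
      using \<omega> unfolding Bad_def time_def by (simp only: Un_iff mem_Collect_eq Diff_iff split: if_splits) auto
  qed
  ultimately show ?thesis
  proof (elim AE_mp, intro AE_I2 impI)
    fix \<omega> assume \<omega>: "\<omega> \<in> space M"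
      and "\<forall>\<^sub>F n in sequentially. \<omega> \<in> space M - bad (Suc n)"
    from this(2) have "\<forall>\<^sub>F n in sequentially. grid_regular X T K W (Suc n) \<omega>"
      by eventually_elim (rule good)
    then show "\<forall>\<^sub>F n in sequentially. grid_regular X T K W n \<omega>"
      using eventually_sequentially_Suc[of "\<lambda>n. grid_regular X T K W n \<omega>"] by blast
  qed
qed

end

section \<open>From the grid to all times, and the quantile inversion\<close>

text \<open>
  Here \<open>q\<close> is the \<open>\<alpha>\<close>-quantile of \<open>G\<close>, described by the signs of
  \<open>G - \<alpha>\<close> on its two sides so that its value at a jump does not matter. The deviation bound places
  \<open>q\<close> within \<open>w / 2\<close> of \<open>z\<close>; on that window \<open>G - Phi\<close> is nearly constant, so
  \<open>G z - \<alpha>\<close> is nearly \<open>G q - Phi q\<close>, that is, nearly \<open>\<alpha> - Phi q\<close>. Taylor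
  expansion of \<open>Phi q\<close> finishes the argument.
\<close>

lemma Bahadur_deterministic:
  fixes G :: "real \<Rightarrow> real"
  assumes z: "Phi z = \<alpha>" "\<bar>z\<bar> + 1 \<le> R"
    and below: "\<And>x. x < q \<Longrightarrow> G x < \<alpha>" and above: "\<And>x. q < x \<Longrightarrow> \<alpha> \<le> G x"
    and dev: "\<bar>G z - Phi z\<bar> \<le> d"
    and osc: "\<And>x. \<bar>x - z\<bar> \<le> w \<Longrightarrow> \<bar>(G x - Phi x) - (G z - Phi z)\<bar> \<le> e"
    and e: "0 < e" "e \<le> w / 2" and w: "w \<le> 1" "2 * (d + e) < phi R * w"
  shows "\<bar>G z - \<alpha> + phi z * (q - z)\<bar> \<le> 2 * e + w\<^sup>2"
proof -
  have w0: "0 < w" using e by linarith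
  have de: "d + e < phi R * (w / 2)" using w by simp
  have q_le: "q \<le> z + w / 2"
  proof (rule ccontr)
    assume "\<not> ?thesis"
    then have "G (z + w/2) < \<alpha>" by (intro below) linarith
    moreover have "phi R * (w/2) \<le> Phi (z + w/2) - Phi z"
      using Phi_increment_lower_bound[of z R "z + w/2"] z w w0 by auto
    moreover have "\<bar>(G (z + w/2) - Phi (z + w/2)) - (G z - Phi z)\<bar> \<le> e"
      using w0 by (intro osc) auto
    ultimately show False using dev de z(1) by linarith
  qed
  have q_ge: "z - w / 2 \<le> q"
  proof (rule ccontr)
    assume "\<not> ?thesis"
    then have "\<alpha> \<le> G (z - w/2)" by (intro above) linarith
    moreover have "phi R * (w/2) \<le> Phi z - Phi (z - w/2)"
      using Phi_increment_lower_bound[of "z - w/2" R z] z w w0 by auto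
    moreover have "\<bar>(G (z - w/2) - Phi (z - w/2)) - (G z - Phi z)\<bar> \<le> e"
      using w0 by (intro osc) auto
    ultimately show False using dev de z(1) by linarith
  qed
  \<comment> \<open>Evaluating \<open>G\<close> at distance \<open>e\<close> on both sides of \<open>q\<close> replaces one-sided limits at the jump.\<close>
  have "\<alpha> \<le> G (q + e)" using e by (intro above) auto
  moreover have "\<bar>(G (q + e) - Phi (q + e)) - (G z - Phi z)\<bar> \<le> e"
    using q_le q_ge e w0 by (intro osc) linarith
  moreover have "\<bar>Phi (q + e) - Phi q\<bar> \<le> e" using Phi_lipschitz[of "q + e" q] e by simp
  moreover have "G (q - e) < \<alpha>" using e by (intro below) auto
  moreover have "\<bar>(G (q - e) - Phi (q - e)) - (G z - Phi z)\<bar> \<le> e"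
    using q_le q_ge e w0 by (intro osc) linarith
  moreover have "\<bar>Phi (q - e) - Phi q\<bar> \<le> e" using Phi_lipschitz[of "q - e" q] e by simp
  ultimately have "\<bar>(G z - \<alpha>) + (Phi q - \<alpha>)\<bar> \<le> 2 * e" using z by linarith
  moreover have "\<bar>Phi q - \<alpha> - phi z * (q - z)\<bar> \<le> w\<^sup>2"
  proof -
    have "(q - z)\<^sup>2 \<le> w\<^sup>2"
      using q_le q_ge w0 by (intro abs_le_square_iff[THEN iffD1]) linarith
    then show ?thesis using Phi_Taylor[of q z] z by linarith
  qed
  ultimately show ?thesis by linarith
qed

text \<open>
  If two samples agree up to a shift of \<open>1 / n\<close>, monotonicity puts the empirical distribution
  function of one between values of the other at levels shifted by at most \<open>2 / n\<close>. The same rounding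
  therefore handles the passage to nearby times and the discretization of the levels.
\<close>

lemma emp_dev_sandwich:
  assumes n: "0 < n" and Rn: "R * real n + 2 \<le> (real n)\<^sup>2" and x: "\<bar>x\<bar> \<le> R"
    and up: "\<And>j x. j \<in> {1..n} \<Longrightarrow> \<bar>x\<bar> \<le> R \<Longrightarrow> Y j \<omega> \<le> x \<Longrightarrow> X j \<omega> \<le> x + 1 / real n"
    and down: "\<And>j x. j \<in> {1..n} \<Longrightarrow> \<bar>x\<bar> \<le> R \<Longrightarrow> X j \<omega> \<le> x - 1 / real n \<Longrightarrow> Y j \<omega> \<le> x"
  shows "\<exists>l\<in>{- (int n)\<^sup>2..(int n)\<^sup>2}. \<exists>m\<in>{- (int n)\<^sup>2..(int n)\<^sup>2}.
    \<bar>of_int l / real n - x\<bar> \<le> 2 / real n \<and> \<bar>of_int m / real n - x\<bar> \<le> 2 / real n \<and>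
    emp_dev X n \<omega> (of_int l / real n) - 2 / real n \<le> emp_dev Y n \<omega> x \<and>
    emp_dev Y n \<omega> x \<le> emp_dev X n \<omega> (of_int m / real n) + 2 / real n"
proof -
  define l m where "l = \<lfloor>x * real n\<rfloor> - 1" and "m = \<lceil>x * real n\<rceil> + 1"
  have l: "x * real n - 2 \<le> of_int l" "of_int l \<le> x * real n - 1" unfolding l_def by linarith+
  have m: "of_int m \<le> x * real n + 2" "x * real n + 1 \<le> of_int m" unfolding m_def by linarith+
  have ln: "x - 2 / real n \<le> of_int l / real n" "of_int l / real n \<le> x - 1 / real n"
    using divide_right_mono[OF l(1), of "real n"] divide_right_mono[OF l(2), of "real n"] n
    by (simp_all add: diff_divide_distrib)
  have mn: "of_int m / real n \<le> x + 2 / real n" "x + 1 / real n \<le> of_int m / real n"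
    using divide_right_mono[OF m(1), of "real n"] divide_right_mono[OF m(2), of "real n"] n
    by (simp_all add: add_divide_distrib)
  have xn: "\<bar>x * real n\<bar> \<le> R * real n" using x n by (simp add: abs_mult)
  have sq: "real_of_int ((int n)\<^sup>2) = (real n)\<^sup>2" by simp
  have 1: "l \<in> {- (int n)\<^sup>2..(int n)\<^sup>2}" "m \<in> {- (int n)\<^sup>2..(int n)\<^sup>2}"
  proof -
    have "- real_of_int ((int n)\<^sup>2) \<le> of_int l" "of_int l \<le> real_of_int ((int n)\<^sup>2)"
      "- real_of_int ((int n)\<^sup>2) \<le> of_int m" "of_int m \<le> real_of_int ((int n)\<^sup>2)"
      unfolding sq using xn l m Rn by linarith+
    then show "l \<in> {- (int n)\<^sup>2..(int n)\<^sup>2}" "m \<in> {- (int n)\<^sup>2..(int n)\<^sup>2}"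
      by (simp_all only: of_int_minus[symmetric] of_int_le_iff atLeastAtMost_iff)
  qed
  have 2: "\<bar>of_int l / real n - x\<bar> \<le> 2 / real n" "\<bar>of_int m / real n - x\<bar> \<le> 2 / real n"
  proof -
    have "0 < 1 / real n" "0 < 2 / real n" using n by auto
    then show "\<bar>of_int l / real n - x\<bar> \<le> 2 / real n" "\<bar>of_int m / real n - x\<bar> \<le> 2 / real n"
      using ln mn by linarith+
  qed
  have "(\<Sum>j=1..n. indicator {..of_int l / real n} (X j \<omega>)) \<le> (\<Sum>j=1..n. indicator {..x} (Y j \<omega>) :: real)"
    using ln by (intro sum_mono) (auto simp: indicator_def intro: down x)
  then have 3: "emp_dev X n \<omega> (of_int l / real n) - 2 / real n \<le> emp_dev Y n \<omega> x"
    using Phi_lipschitz[of x "of_int l / real n"] 2(1) n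
      divide_right_mono[of "\<Sum>j=1..n. indicator {..of_int l / real n} (X j \<omega>)" "\<Sum>j=1..n. indicator {..x} (Y j \<omega>)" "real n"]
    unfolding emp_dev_def by linarith
  have "(\<Sum>j=1..n. indicator {..x} (Y j \<omega>)) \<le> (\<Sum>j=1..n. indicator {..of_int m / real n} (X j \<omega>) :: real)"
    using mn by (intro sum_mono) (auto simp: indicator_def intro: order_trans[OF up[OF _ x] mn(2)])
  then have 4: "emp_dev Y n \<omega> x \<le> emp_dev X n \<omega> (of_int m / real n) + 2 / real n"
    using Phi_lipschitz[of x "of_int m / real n"] 2(2) n
      divide_right_mono[of "\<Sum>j=1..n. indicator {..x} (Y j \<omega>)" "\<Sum>j=1..n. indicator {..of_int m / real n} (X j \<omega>)" "real n"]
    unfolding emp_dev_def by linarith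
  show ?thesis using 1 2 3 4 by blast
qed

lemma emp_dev_transfer:
  fixes D E :: "real \<Rightarrow> real"
  assumes n: "0 < n"
    and sandwich: "\<And>x. \<bar>x\<bar> \<le> R \<Longrightarrow> \<exists>l\<in>Z. \<exists>m\<in>Z.
      \<bar>of_int l / real n - x\<bar> \<le> 2 / real n \<and> \<bar>of_int m / real n - x\<bar> \<le> 2 / real n \<and>
      D (of_int l / real n) - 2 / real n \<le> E x \<and> E x \<le> D (of_int m / real n) + 2 / real n"
    and grid: "\<And>l m. l \<in> Z \<Longrightarrow> m \<in> Z \<Longrightarrow> \<bar>D (of_int l / real n)\<bar> \<le> d \<and>
      (\<bar>of_int l / real n - of_int m / real n\<bar> \<le> w + 4 / real n \<longrightarrow>
       \<bar>D (of_int l / real n) - D (of_int m / real n)\<bar> \<le> e)"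
  shows "\<bar>x\<bar> \<le> R \<Longrightarrow> \<bar>E x\<bar> \<le> d + 2 / real n"
    and "\<bar>x\<bar> \<le> R \<Longrightarrow> \<bar>y\<bar> \<le> R \<Longrightarrow> \<bar>x - y\<bar> \<le> w \<Longrightarrow> \<bar>E x - E y\<bar> \<le> e + 4 / real n"
proof -
  show "\<bar>E x\<bar> \<le> d + 2 / real n" if "\<bar>x\<bar> \<le> R" for x
  proof -
    have "\<exists>l\<in>Z. \<exists>m\<in>Z. D (of_int l / real n) - 2 / real n \<le> E x \<and>
        E x \<le> D (of_int m / real n) + 2 / real n"
      using sandwich[OF that] by blast
    then obtain l m where lm: "l \<in> Z" "m \<in> Z" "D (of_int l / real n) - 2 / real n \<le> E x"
        "E x \<le> D (of_int m / real n) + 2 / real n"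
      by blast
    then show ?thesis using grid[OF lm(1,2)] grid[OF lm(2,1)] by linarith
  qed
  have half: "E x - E y \<le> e + 4 / real n" if xy: "\<bar>x\<bar> \<le> R" "\<bar>y\<bar> \<le> R" "\<bar>x - y\<bar> \<le> w" for x y
  proof -
    obtain m where m: "m \<in> Z" "\<bar>of_int m / real n - x\<bar> \<le> 2 / real n"
        "E x \<le> D (of_int m / real n) + 2 / real n"
      using sandwich[OF xy(1)] by blast
    obtain l where l: "l \<in> Z" "\<bar>of_int l / real n - y\<bar> \<le> 2 / real n"
        "D (of_int l / real n) - 2 / real n \<le> E y"
      using sandwich[OF xy(2)] by blast
    have "\<bar>of_int m / real n - of_int l / real n\<bar> \<le> w + 4 / real n"
      using m(2) l(2) xy(3) by (simp add: abs_le_iff)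
    then have "\<bar>D (of_int m / real n) - D (of_int l / real n)\<bar> \<le> e"
      using grid[OF m(1) l(1)] by blast
    then show ?thesis using m(3) l(3) by linarith
  qed
  show "\<bar>E x - E y\<bar> \<le> e + 4 / real n" if xy: "\<bar>x\<bar> \<le> R" "\<bar>y\<bar> \<le> R" "\<bar>x - y\<bar> \<le> w" for x y
    using half[OF xy] half[of y x] xy by (simp add: abs_le_iff)
qed

text \<open>
  The samples at two nearby times \<open>t \<le> s\<close> are compared after division by the standard
  deviation. The change of scale is controlled by \<open>(t / s) powr H \<ge> t / s\<close>, which holds since
  \<open>H < 1\<close>.
\<close>

lemma rescaled_close:
  fixes a b :: real
  assumes H: "0 < H" "H < 1" and t: "0 < t" "t \<le> s"
    and ab: "\<bar>b - a\<bar> \<le> \<eta>"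
    and small: "R * ((s - t) / s) + \<eta> / s powr H \<le> \<kappa>"
    and x: "\<bar>x\<bar> \<le> R"
  shows "a / t powr H \<le> x \<Longrightarrow> b / s powr H \<le> x + \<kappa>"
    and "b / s powr H \<le> x - \<kappa> \<Longrightarrow> a / t powr H \<le> x"
proof -
  define r where "r = (t / s) powr H"
  have s: "0 < s" using t by linarith
  have ts: "0 < t / s" "t / s \<le> 1" using t s by auto
  have r1: "r \<le> 1" unfolding r_def using ts H by (intro powr_le1) auto
  have "t / s = (t / s) powr 1" using ts(1) by (intro powr_one[symmetric]) simp
  also have "\<dots> \<le> r" unfolding r_def using ts H by (intro powr_mono') auto
  finally have r2: "1 - r \<le> (s - t) / s" using s by (simp add: diff_divide_distrib)
  have r0: "0 < r" using t s by (simp add: r_def)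
  have eq: "b / s powr H = (a / t powr H) * r + (b - a) / s powr H"
  proof -
    have "(a / t powr H) * r = a / s powr H"
      using t s by (simp add: r_def powr_divide)
    then show ?thesis by (simp add: diff_divide_distrib)
  qed
  have err: "\<bar>(b - a) / s powr H\<bar> \<le> \<eta> / s powr H"
    using ab by (simp add: abs_divide divide_right_mono)
  have xr: "\<bar>x - x * r\<bar> \<le> R * ((s - t) / s)"
  proof -
    have "\<bar>x - x * r\<bar> = \<bar>x\<bar> * (1 - r)"
    proof -
      have "x - x * r = x * (1 - r)" by (simp add: right_diff_distrib)
      then show ?thesis using r1 by (simp add: abs_mult)
    qed
    also have "\<dots> \<le> R * ((s - t) / s)" using x r1 r2 by (intro mult_mono) auto
    finally show ?thesis .
  qed
  show "b / s powr H \<le> x + \<kappa>" if "a / t powr H \<le> x"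
  proof -
    have "(a / t powr H) * r \<le> x * r" using that r0 by (intro mult_right_mono) auto
    then show ?thesis unfolding eq using err xr small by linarith
  qed
  show "a / t powr H \<le> x" if *: "b / s powr H \<le> x - \<kappa>"
  proof (rule ccontr)
    assume "\<not> ?thesis"
    then have "x * r < (a / t powr H) * r" using r0 by (intro mult_strict_right_mono) auto
    then show False using * unfolding eq using err xr small by linarith
  qed
qed

lemma F_emp_mono: "x \<le> y \<Longrightarrow> F_emp B n \<omega> t x \<le> F_emp B n \<omega> t y"
  unfolding F_emp_def by (intro divide_right_mono sum_mono) (auto simp: indicator_def)

lemma F_emp_bounds: "0 \<le> F_emp B n \<omega> t x" "F_emp B n \<omega> t x \<le> 1"
proof -
  show "0 \<le> F_emp B n \<omega> t x" by (simp add: F_emp_def sum_nonneg)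
  have "(\<Sum>j=1..n. indicator {..x} (B j t \<omega>)) \<le> (\<Sum>j=1..n. 1 :: real)"
    by (intro sum_mono) (auto simp: indicator_def)
  then show "F_emp B n \<omega> t x \<le> 1" by (cases "n = 0") (simp_all add: F_emp_def field_simps)
qed

lemma F_emp_eq_0:
  assumes "\<And>j. j \<in> {1..n} \<Longrightarrow> x < B j t \<omega>" shows "F_emp B n \<omega> t x = 0"
proof -
  have "(\<Sum>j=1..n. indicator {..x} (B j t \<omega>) :: real) = 0"
    by (intro sum.neutral ballI) (use assms in \<open>force simp: indicator_def\<close>)
  then show ?thesis by (simp add: F_emp_def)
qed

lemma F_emp_eq_1:
  assumes "\<And>j. j \<in> {1..n} \<Longrightarrow> B j t \<omega> \<le> x" and "0 < n" shows "F_emp B n \<omega> t x = 1"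
proof -
  have "(\<Sum>j=1..n. indicator {..x} (B j t \<omega>)) = (\<Sum>j=1..n. 1 :: real)"
    using assms(1) by (intro sum.cong) auto
  then show ?thesis using assms(2) by (simp add: F_emp_def)
qed

text \<open>
  This is the form in which \<open>Bahadur_deterministic\<close> uses the empirical quantile. The infimum is
  over a nonempty set bounded below, since the empirical distribution function is \<open>1\<close> above and
  \<open>0\<close> below all sample points.
\<close>

lemma tau_emp_separates:
  assumes "0 < n" and \<alpha>: "0 < \<alpha>" "\<alpha> \<le> 1"
  shows "x < tau_emp B n \<omega> \<alpha> t \<Longrightarrow> F_emp B n \<omega> t x < \<alpha>"
    and "tau_emp B n \<omega> \<alpha> t < x \<Longrightarrow> \<alpha> \<le> F_emp B n \<omega> t x"
proof -
  let ?S = "{x. F_emp B n \<omega> t x \<ge> \<alpha>}"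
  let ?b = "\<Sum>j\<in>{1..n}. \<bar>B j t \<omega>\<bar>"
  have b: "\<bar>B j t \<omega>\<bar> \<le> ?b" if "j \<in> {1..n}" for j
    using that by (intro member_le_sum) auto
  have "F_emp B n \<omega> t ?b = 1" using b assms by (intro F_emp_eq_1) (auto simp: abs_le_iff)
  then have "?b \<in> ?S" using \<alpha> by (simp only: mem_Collect_eq)
  then have ne: "?S \<noteq> {}" by blast
  have bdd: "bdd_below ?S"
  proof (rule bdd_belowI[of _ "- ?b"])
    fix x assume "x \<in> ?S"
    show "- ?b \<le> x"
    proof (rule ccontr)
      assume "\<not> ?thesis"
      then have "F_emp B n \<omega> t x = 0" using b by (intro F_emp_eq_0) (smt (verit))
      then show False using \<open>x \<in> ?S\<close> \<alpha> by simp
    qed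
  qed
  show "F_emp B n \<omega> t x < \<alpha>" if "x < tau_emp B n \<omega> \<alpha> t"
    using that cInf_lower[OF _ bdd, of x] unfolding tau_emp_def by fastforce
  show "\<alpha> \<le> F_emp B n \<omega> t x" if "tau_emp B n \<omega> \<alpha> t < x"
  proof -
    have "\<exists>y\<in>?S. y < x" using that unfolding tau_emp_def by (rule cInf_lessD[OF ne])
    then obtain y where "y \<in> ?S" "y < x" by blast
    then show ?thesis using F_emp_mono[of y x B n \<omega> t] by simp
  qed
qed

lemma tau_emp_bounded:
  assumes n: "0 < n" and \<alpha>: "0 < \<alpha>" "\<alpha> \<le> 1" and b: "\<And>j. j \<in> {1..n} \<Longrightarrow> \<bar>B j t \<omega>\<bar> \<le> \<eta>"
  shows "\<bar>tau_emp B n \<omega> \<alpha> t\<bar> \<le> \<eta>"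
proof -
  have "\<not> \<eta> < tau_emp B n \<omega> \<alpha> t"
  proof
    assume "\<eta> < tau_emp B n \<omega> \<alpha> t"
    then have "F_emp B n \<omega> t \<eta> < \<alpha>" by (rule tau_emp_separates(1)[OF n \<alpha>])
    moreover have "F_emp B n \<omega> t \<eta> = 1" using b n by (intro F_emp_eq_1) (auto simp: abs_le_iff)
    ultimately show False using \<alpha> by simp
  qed
  moreover have "\<not> tau_emp B n \<omega> \<alpha> t < - \<eta>"
  proof
    assume "tau_emp B n \<omega> \<alpha> t < - \<eta>"
    then obtain x where x: "tau_emp B n \<omega> \<alpha> t < x" "x < - \<eta>" using dense by blast
    then have "\<alpha> \<le> F_emp B n \<omega> t x" by (intro tau_emp_separates(2)[OF n \<alpha>])
    moreover have "F_emp B n \<omega> t x = 0" using b x by (intro F_emp_eq_0) (smt (verit))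
    ultimately show False using \<alpha> by simp
  qed
  ultimately show ?thesis by linarith
qed

section \<open>The Bahadur-Kiefer error of the time dependent quantile process\<close>

text \<open>
  The left side is the total shift in \<open>rescaled_close\<close> between a time
  \<open>t \<ge> n powr (- 4 / H)\<close> and the next grid time. The Hoelder term is of order
  \<open>n\<close> to the power \<open>1 - 8 + 4 = - 3\<close>, which explains the exponent \<open>16 / H\<close>.
\<close>

lemma eventually_grid_fine:
  fixes R T C H :: real
  assumes H: "0 < H" "H < 1" and pos: "0 < R" "0 < T" "0 < C" and K: "16 / H \<le> real K"
  shows "\<forall>\<^sub>F n in sequentially. R * (T / real (n ^ K)) * real n powr (4 / H)
      + C * real n * (T / real (n ^ K)) powr (H / 2) * real n ^ 4 \<le> 1 / real n"
proof -
  define a b where "a = R * T" and "b = C * T powr (H / 2)"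
  have ab: "0 < a" "0 < b" using pos by (auto simp: a_def b_def)
  have "\<forall>\<^sub>F n in sequentially. a * real n powr (-12) + b * real n powr (-3) \<le> 1 / real n"
    using ab by real_asymp
  then show ?thesis using eventually_gt_at_top[of 0]
  proof eventually_elim
    case (elim n)
    then have n: "1 \<le> real n" by simp
    have "real n powr (16 / H) \<le> real n powr real K" using n K by (intro powr_mono) auto
    then have nK: "real n powr (16 / H) \<le> real (n ^ K)" using n by (simp add: powr_realpow)
    have "T / real (n ^ K) \<le> T / real n powr (16 / H)"
      using pos n nK by (intro divide_left_mono) auto
    also have "\<dots> = T * real n powr (- 16 / H)" by (simp add: powr_minus divide_inverse)
    finally have mesh: "T / real (n ^ K) \<le> T * real n powr (- 16 / H)" .
    have "R * (T / real (n ^ K)) * real n powr (4 / H) \<le> R * (T * real n powr (- 16 / H)) * real n powr (4 / H)"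
      using pos by (intro mult_right_mono mult_left_mono mesh) auto
    also have "\<dots> = a * real n powr (- 12 / H)"
    proof -
      have "real n powr (- 16 / H) * real n powr (4 / H) = real n powr (- 12 / H)"
        by (simp add: powr_add[symmetric] add_divide_distrib[symmetric])
      then show ?thesis by (simp add: a_def)
    qed
    also have "\<dots> \<le> a * real n powr (-12)"
      using ab n H by (intro mult_left_mono powr_mono) (auto simp: field_simps)
    finally have 1: "R * (T / real (n ^ K)) * real n powr (4 / H) \<le> a * real n powr (-12)" .
    have "(T / real (n ^ K)) powr (H / 2) \<le> (T * real n powr (- 16 / H)) powr (H / 2)"
      using pos n H by (intro powr_mono2 mesh) auto
    also have "\<dots> = T powr (H / 2) * real n powr (- 8)"
      using pos H by (simp add: powr_mult powr_powr)
    finally have "C * real n * (T / real (n ^ K)) powr (H / 2) * real n ^ 4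
        \<le> C * real n * (T powr (H / 2) * real n powr (- 8)) * real n ^ 4"
      using pos by (intro mult_right_mono mult_left_mono) auto
    also have "\<dots> = b * (real n powr 1 * real n powr (- 8) * real n powr (real 4))"
      using n by (simp add: b_def powr_realpow del: of_nat_numeral)
    also have "real n powr 1 * real n powr (- 8) * real n powr (real 4) = real n powr (- 3)"
      by (simp only: powr_add[symmetric]) simp
    finally show ?case using 1 elim(1) by linarith
  qed
qed

lemma emp_dev_rescaled:
  assumes "0 < t"
  shows "emp_dev (\<lambda>j \<omega>. B j t \<omega> / t powr H) n \<omega> x = F_emp B n \<omega> t (t powr H * x) - Phi x"
proof -
  have "indicator {..x} (b / t powr H) = (indicator {..t powr H * x} b :: real)" for b
    using assms by (auto simp: indicator_def field_simps)
  then show ?thesis by (simp add: emp_dev_def F_emp_def)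
qed

text \<open>
  Regularity on the grid is carried to the time \<open>t\<close> by the sandwich with the next grid time
  \<open>s \<ge> t\<close>, and the deterministic quantile inversion applies to the rescaled sample at \<open>t\<close>.
\<close>

lemma Bahadur_large_time:
  assumes H: "0 < H" "H < 1" and C: "0 < C" and T: "0 < T" and R: "0 < R"
    and n: "0 < n" and Rn: "R * real n + 2 \<le> (real n)\<^sup>2"
    and w: "17 / phi R * real n powr (- 11/24) \<le> 1"
    and fine: "R * (T / real (n ^ K)) * real n powr (4 / H)
      + C * real n * (T / real (n ^ K)) powr (H / 2) * real n ^ 4 \<le> 1 / real n"
    and Holder: "\<And>j s t. j \<in> {1..n} \<Longrightarrow> s \<in> {0..T} \<Longrightarrow> t \<in> {0..T} \<Longrightarrow>
      \<bar>B j t \<omega> - B j s \<omega>\<bar> \<le> C * real n * \<bar>t - s\<bar> powr (H / 2)"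
    and grid: "grid_regular (\<lambda>s j \<omega>. B j s \<omega> / s powr H) T K (17 / phi R + 4) n \<omega>"
    and t: "real n powr (- 4 / H) \<le> t" "t \<le> T"
    and \<alpha>: "0 < \<alpha>" "\<alpha> \<le> 1" and z: "Phi z = \<alpha>" "\<bar>z\<bar> + 1 \<le> R"
  shows "\<bar>F_emp B n \<omega> t (t powr H * z) - \<alpha> + phi z * (tau_emp B n \<omega> \<alpha> t / t powr H - z)\<bar>
       \<le> 2 * (real n powr (- 2/3) + 4 / real n) + (17 / phi R * real n powr (- 11/24))\<^sup>2"
proof -
  define X where "X = (\<lambda>s j \<omega>. B j s \<omega> / s powr H)"
  define c where "c = phi R"
  \<comment> \<open>The window: \<open>d\<close> and \<open>e\<close> are at most \<open>3\<close> and \<open>5\<close> times \<open>n powr (- 11/24)\<close>, and \<open>2 * (3 + 5) < 17\<close>.\<close>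
  define w0 where "w0 = 17 / c * real n powr (- 11/24)"
  have c: "0 < c" "c \<le> 1" using normal_density_pos[of 1 0 R] phi_le_one[of R] by (auto simp: c_def)
  have n1: "1 \<le> real n" using n by simp
  have t0: "0 < t" using t(1) n by (smt (verit) powr_gt_zero of_nat_0_less_iff)
  define h where "h = T / real (n ^ K)"
  have h: "0 < h" using T n by (simp add: h_def)
  \<comment> \<open>Rounding up rather than down keeps \<open>s \<ge> t\<close>, away from time zero.\<close>
  define i where "i = nat \<lceil>t / h\<rceil>"
  have ti: "t / h \<le> real i" "real i < t / h + 1"
    using t0 h unfolding i_def by (auto simp: of_nat_nat) linarith+
  have "0 < t / h" using t0 h by simp
  then have i1: "1 \<le> i" using ti(1) by linarith
  have "t / h \<le> real (n ^ K)" using t T n by (simp add: h_def field_simps)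
  then have "\<lceil>t / h\<rceil> \<le> int (n ^ K)" by (simp only: ceiling_le_iff of_int_of_nat_eq)
  then have i: "i \<in> {1..n ^ K}" using i1 by (simp add: i_def nat_le_iff)
  define s where "s = T * real i / real (n ^ K)"
  have s_eq: "s = h * real i" by (simp add: s_def h_def)
  have ts: "t \<le> s" using ti(1) h by (simp add: s_eq field_simps)
  have st: "s - t \<le> h" using ti(2) h by (simp add: s_eq field_simps)
  have "real i \<le> real (n ^ K)" using i by (simp only: atLeastAtMost_iff of_nat_le_iff)
  then have sT: "s \<le> T" using T n by (simp add: s_def field_simps)
  have s0: "0 < s" using t0 ts by linarith
  define \<eta> where "\<eta> = C * real n * h powr (H / 2)"
  have close: "R * ((s - t) / s) + \<eta> / s powr H \<le> 1 / real n"
  proof -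
    have inv: "1 / s \<le> real n powr (4 / H)"
    proof -
      have "1 / s \<le> 1 / real n powr (- 4 / H)" using t(1) ts s0 n by (intro divide_left_mono) auto
      then show ?thesis by (simp add: powr_minus divide_inverse)
    qed
    have "(s - t) * (1 / s) \<le> h * real n powr (4 / H)"
      using st inv s0 h by (intro mult_mono) auto
    then have "R * ((s - t) * (1 / s)) \<le> R * (h * real n powr (4 / H))"
      using R by (intro mult_left_mono) auto
    then have "R * ((s - t) / s) \<le> R * h * real n powr (4 / H)"
      by (simp add: mult.assoc)
    moreover have "\<eta> / s powr H \<le> C * real n * h powr (H / 2) * real n ^ 4"
    proof -
      have "1 / s powr H = (1 / s) powr H" using s0 by (simp add: powr_divide)
      also have "\<dots> \<le> (real n powr (4 / H)) powr H" using inv s0 H by (intro powr_mono2) auto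
      also have "\<dots> = real n powr (real 4)" using H by (simp add: powr_powr)
      also have "\<dots> = real n ^ 4" using n by (simp only: powr_realpow of_nat_0_less_iff)
      finally have "\<eta> * (1 / s powr H) \<le> \<eta> * real n ^ 4"
        using C by (intro mult_left_mono) (auto simp: \<eta>_def)
      then show ?thesis by (simp add: \<eta>_def)
    qed
    ultimately show ?thesis using fine unfolding h_def[symmetric] by linarith
  qed
  have near: "\<bar>B j s \<omega> - B j t \<omega>\<bar> \<le> \<eta>" if "j \<in> {1..n}" for j
  proof -
    have "\<bar>B j s \<omega> - B j t \<omega>\<bar> \<le> C * real n * \<bar>s - t\<bar> powr (H / 2)"
      using that t0 s0 t sT by (intro Holder) auto
    also have "\<dots> \<le> \<eta>" unfolding \<eta>_def
      using ts st C H by (intro mult_left_mono powr_mono2) auto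
    finally show ?thesis .
  qed
  define E where "E = emp_dev (X t) n \<omega>"
  define D where "D = emp_dev (X s) n \<omega>"
  have E_eq: "E x = F_emp B n \<omega> t (t powr H * x) - Phi x" for x
    unfolding E_def X_def using t0 by (rule emp_dev_rescaled)
  define Z where "Z = {- (int n)\<^sup>2..(int n)\<^sup>2}"
  have sandwich: "\<exists>l\<in>Z. \<exists>m\<in>Z.
      \<bar>of_int l / real n - x\<bar> \<le> 2 / real n \<and> \<bar>of_int m / real n - x\<bar> \<le> 2 / real n \<and>
      D (of_int l / real n) - 2 / real n \<le> E x \<and> E x \<le> D (of_int m / real n) + 2 / real n"
    if "\<bar>x\<bar> \<le> R" for x
  proof -
    have up: "X s j \<omega> \<le> x + 1 / real n" if "j \<in> {1..n}" "\<bar>x\<bar> \<le> R" "X t j \<omega> \<le> x" for j x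
      using rescaled_close(1)[OF H t0 ts near[OF that(1)] close that(2)] that(3) by (simp add: X_def)
    have down: "X t j \<omega> \<le> x" if "j \<in> {1..n}" "\<bar>x\<bar> \<le> R" "X s j \<omega> \<le> x - 1 / real n" for j x
      using rescaled_close(2)[OF H t0 ts near[OF that(1)] close that(2)] that(3) by (simp add: X_def)
    show ?thesis
      unfolding E_def D_def Z_def
      by (rule emp_dev_sandwich[OF n Rn that]; (rule up | rule down); assumption)
  qed
  have inv_n: "1 / real n \<le> real n powr (- 11/24)"
  proof -
    have "1 / real n = real n powr (- 1)" using n by (simp only: powr_neg_one of_nat_0_less_iff)
    also have "\<dots> \<le> real n powr (- 11/24)" using n1 by (intro powr_mono) simp_all
    finally show ?thesis .
  qed
  have gridD: "\<bar>D (of_int l / real n)\<bar> \<le> real n powr (- 11/24) \<and>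
      (\<bar>of_int l / real n - of_int m / real n\<bar> \<le> w0 + 4 / real n \<longrightarrow>
       \<bar>D (of_int l / real n) - D (of_int m / real n)\<bar> \<le> real n powr (- 2/3))"
    if "l \<in> Z" "m \<in> Z" for l m
  proof -
    have "w0 + 4 / real n \<le> (17 / phi R + 4) * real n powr (- 11/24)"
      using inv_n by (simp add: w0_def c_def distrib_right)
    moreover have "\<bar>D (of_int l / real n)\<bar> \<le> real n powr (- 11/24) \<and>
      (\<bar>of_int l / real n - of_int m / real n\<bar> \<le> (17 / phi R + 4) * real n powr (- 11/24) \<longrightarrow>
       \<bar>D (of_int l / real n) - D (of_int m / real n)\<bar> \<le> real n powr (- 2/3))"
      using grid i that unfolding grid_regular_def Let_def D_def X_def s_def Z_def by blast
    ultimately show ?thesis by linarith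
  qed
  have dev: "\<bar>E x\<bar> \<le> real n powr (- 11/24) + 2 / real n" if "\<bar>x\<bar> \<le> R" for x
    by (rule emp_dev_transfer(1)[where D = D and Z = Z and R = R and w = w0, OF n])
       (fact sandwich gridD that)+
  have osc: "\<bar>E x - E y\<bar> \<le> real n powr (- 2/3) + 4 / real n"
    if "\<bar>x\<bar> \<le> R" "\<bar>y\<bar> \<le> R" "\<bar>x - y\<bar> \<le> w0" for x y
    by (rule emp_dev_transfer(2)[where D = D and Z = Z and R = R and w = w0, OF n])
       (fact sandwich gridD that)+
  define d e where "d = real n powr (- 11/24) + 2 / real n" and "e = real n powr (- 2/3) + 4 / real n"
  have n23: "real n powr (- 2/3) \<le> real n powr (- 11/24)" using n1 by (intro powr_mono) auto
  have d3: "d \<le> 3 * real n powr (- 11/24)" and e5: "e \<le> 5 * real n powr (- 11/24)"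
    using inv_n n23 by (auto simp: d_def e_def)
  have pos: "0 < real n powr (- 11/24)" using n by simp
  have e0: "0 < e" using n by (auto simp: e_def intro: add_pos_pos)
  have cw: "c * w0 = 17 * real n powr (- 11/24)" using c by (simp add: w0_def)
  have w0: "0 < w0" using pos c by (simp add: w0_def)
  have "c * w0 \<le> 1 * w0" using c w0 by (intro mult_right_mono) auto
  then have w17: "17 * real n powr (- 11/24) \<le> w0" by (simp add: cw)
  let ?q = "tau_emp B n \<omega> \<alpha> t / t powr H"
  have tH: "0 < t powr H" using t0 by simp
  have "\<bar>F_emp B n \<omega> t (t powr H * z) - \<alpha> + phi z * (?q - z)\<bar> \<le> 2 * e + w0\<^sup>2"
  proof (rule Bahadur_deterministic[where G = "\<lambda>x. F_emp B n \<omega> t (t powr H * x)" and R = R and d = d])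
    show "F_emp B n \<omega> t (t powr H * x) < \<alpha>" if "x < ?q" for x
      using that tH by (intro tau_emp_separates(1)[OF n \<alpha>]) (simp add: field_simps)
    show "\<alpha> \<le> F_emp B n \<omega> t (t powr H * x)" if "?q < x" for x
      using that tH by (intro tau_emp_separates(2)[OF n \<alpha>]) (simp add: field_simps)
    show "\<bar>F_emp B n \<omega> t (t powr H * z) - Phi z\<bar> \<le> d"
      using dev[of z] z by (simp add: E_eq d_def)
    show "w0 \<le> 1" using w by (simp add: w0_def c_def)
    show "\<bar>(F_emp B n \<omega> t (t powr H * x) - Phi x) - (F_emp B n \<omega> t (t powr H * z) - Phi z)\<bar> \<le> e"
      if "\<bar>x - z\<bar> \<le> w0" for x
    proof -
      have "\<bar>x\<bar> \<le> R" "\<bar>z\<bar> \<le> R" using that z(2) \<open>w0 \<le> 1\<close> by linarith+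
      then show ?thesis using osc[of x z] that by (simp add: E_eq e_def)
    qed
    show "e \<le> w0 / 2" using e5 w17 pos by linarith
    have "2 * (d + e) \<le> 2 * (8 * real n powr (- 11/24))"
      using add_mono[OF d3 e5] by (intro mult_left_mono) auto
    also have "\<dots> < 17 * real n powr (- 11/24)" using pos by simp
    finally have "2 * (d + e) < 17 * real n powr (- 11/24)" .
    then show "2 * (d + e) < phi R * w0" by (simp only: cw c_def[symmetric])
  qed (use z e0 in auto)
  then show ?thesis by (simp add: e_def w0_def c_def)
qed

text \<open>
  Near time zero no cancellation is needed: all sample paths, the quantiles and the factor
  \<open>a = t powr H\<close> are so small that the triangle inequality suffices.
\<close>

lemma Bahadur_small_time:
  assumes n: "0 < n" and \<alpha>: "0 < \<alpha>" "\<alpha> \<le> 1"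
    and small: "\<And>j. j \<in> {1..n} \<Longrightarrow> \<bar>B j t \<omega>\<bar> \<le> \<eta>"
    and p: "0 \<le> p" "p \<le> 1" and a: "0 \<le> a" "a \<le> b" and z: "\<bar>z\<bar> \<le> R" and F: "0 \<le> F" "F \<le> 1"
  shows "\<bar>a * (sqrt (real n) * (F_emp B n \<omega> t x - F)) + p * (sqrt (real n) * (tau_emp B n \<omega> \<alpha> t - a * z))\<bar>
     \<le> sqrt (real n) * (b * (1 + R) + \<eta>)"
proof -
  have 1: "\<bar>a * (F_emp B n \<omega> t x - F)\<bar> \<le> b * 1"
    unfolding abs_mult using a F F_emp_bounds[of B n \<omega> t x] by (intro mult_mono) auto
  have 2: "\<bar>tau_emp B n \<omega> \<alpha> t - a * z\<bar> \<le> \<eta> + b * R"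
  proof -
    have "\<bar>a * z\<bar> \<le> b * R" unfolding abs_mult using a z by (intro mult_mono) auto
    then show ?thesis using tau_emp_bounded[where B = B and t = t and \<omega> = \<omega>, OF n \<alpha> small] by linarith
  qed
  have 3: "\<bar>p * (tau_emp B n \<omega> \<alpha> t - a * z)\<bar> \<le> 1 * (\<eta> + b * R)"
    unfolding abs_mult using p 2 by (intro mult_mono) auto
  have "\<bar>a * (sqrt (real n) * (F_emp B n \<omega> t x - F)) + p * (sqrt (real n) * (tau_emp B n \<omega> \<alpha> t - a * z))\<bar>
      = sqrt (real n) * \<bar>a * (F_emp B n \<omega> t x - F) + p * (tau_emp B n \<omega> \<alpha> t - a * z)\<bar>"
  proof -
    have "a * (sqrt (real n) * (F_emp B n \<omega> t x - F)) + p * (sqrt (real n) * (tau_emp B n \<omega> \<alpha> t - a * z))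
        = sqrt (real n) * (a * (F_emp B n \<omega> t x - F) + p * (tau_emp B n \<omega> \<alpha> t - a * z))"
      by (simp add: algebra_simps)
    then show ?thesis by (simp add: abs_mult)
  qed
  also have "\<dots> \<le> sqrt (real n) * (b * (1 + R) + \<eta>)"
    using 1 3 by (intro mult_left_mono) (auto simp: algebra_simps)
  finally show ?thesis .
qed

context prob_space
begin

lemma fBM_marginal_cdf:
  assumes X: "fractional_BM M H X" and t: "0 < t"
  shows "prob {\<omega> \<in> space M. X t \<omega> / t powr H \<le> x} = Phi x"
  using t by (intro centered_gaussian_cdf fBM_gaussian(1,2)[OF X])
    (auto simp: fBM_gaussian(3)[OF X] powr_square)

lemma F_cdf_eq_Phi:
  assumes "fractional_BM M H (B 0)" and t: "0 < t"
  shows "F_cdf M B t x = Phi (x / t powr H)"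
proof -
  have "{\<omega> \<in> space M. B 0 t \<omega> \<le> x} = {\<omega> \<in> space M. B 0 t \<omega> / t powr H \<le> x / t powr H}"
    using t by (auto simp: divide_le_cancel)
  then show ?thesis using fBM_marginal_cdf[OF assms] by (simp add: F_cdf_def)
qed

lemma fBM_starts_at_0:
  assumes X: "fractional_BM M H X" and H: "0 < H"
  shows "AE \<omega> in M. X 0 \<omega> = 0"
proof -
  note g = fBM_gaussian[OF X order_refl]
  have "AE \<omega> in M. (X 0 \<omega>)\<^sup>2 = 0"
    using g(3) H centered_gaussian_integrable_power[OF g(1,2), of 2]
    by (subst integral_nonneg_eq_0_iff_AE[symmetric]) auto
  then show ?thesis by simp
qed

lemma tau_eq:
  assumes X: "fractional_BM M H (B 0)" and H: "0 < H" and t: "0 \<le> t" and \<alpha>: "0 < \<alpha>" "\<alpha> < 1"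
  shows "tau M B \<alpha> t = t powr H * z_quantile \<alpha>"
proof (cases "t = 0")
  case False
  then have t0: "0 < t" using t by simp
  have "{x. \<alpha> \<le> F_cdf M B t x} = {t powr H * z_quantile \<alpha>..}"
  proof -
    have "\<alpha> \<le> F_cdf M B t x \<longleftrightarrow> t powr H * z_quantile \<alpha> \<le> x" for x
    proof -
      have "\<alpha> \<le> F_cdf M B t x \<longleftrightarrow> Phi (z_quantile \<alpha>) \<le> Phi (x / t powr H)"
        by (simp add: F_cdf_eq_Phi[where B = B, OF X t0] Phi_z_quantile[OF \<alpha>])
      also have "\<dots> \<longleftrightarrow> z_quantile \<alpha> \<le> x / t powr H" by (rule strict_mono_less_eq[OF Phi_strict_mono])
      also have "\<dots> \<longleftrightarrow> t powr H * z_quantile \<alpha> \<le> x" using t0 by (simp add: field_simps)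
      finally show ?thesis .
    qed
    then show ?thesis by auto
  qed
  then show ?thesis by (simp add: tau_def)
next
  case True
  have ae: "AE \<omega> in M. B 0 0 \<omega> = 0" by (rule fBM_starts_at_0[OF X H])
  have [measurable]: "B 0 0 \<in> borel_measurable M" using fBM_measurable[OF X] by simp
  have "F_cdf M B 0 x = (if 0 \<le> x then 1 else 0)" for x
  proof -
    have "F_cdf M B 0 x = prob {\<omega> \<in> space M. 0 \<le> x}"
      unfolding F_cdf_def using ae by (intro finite_measure_eq_AE) auto
    then show ?thesis by (simp add: prob_space)
  qed
  then have "{x. \<alpha> \<le> F_cdf M B 0 x} = {0..}" using \<alpha> by auto
  then show ?thesis using True by (simp add: tau_def)
qed

text \<open>
  Independence is assumed for whole trajectories; evaluation at a fixed time is measurable on the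
  trajectory space and so preserves it.
\<close>

lemma iid_fBM_marginals_indep:
  assumes B: "iid_fractional_BMs M H B" and s: "0 < s"
  shows "indep_vars (\<lambda>_. borel) (\<lambda>j \<omega>. B j s \<omega> / s powr H) UNIV"
proof -
  have "indep_vars (\<lambda>_. borel) (\<lambda>j \<omega>. trajectory (B j) \<omega> s / s powr H) UNIV"
  proof (rule indep_vars_compose2[where Y = "\<lambda>_ f. f s / s powr H"])
    show "indep_vars (\<lambda>_. trajectory_space) (\<lambda>j. trajectory (B j)) UNIV"
      using B by (simp add: iid_fractional_BMs_def)
    have "(\<lambda>f. f s) \<in> trajectory_space \<rightarrow>\<^sub>M borel"
      unfolding trajectory_space_def using s by (intro measurable_component_singleton) auto
    then show "(\<lambda>f. f s / s powr H) \<in> trajectory_space \<rightarrow>\<^sub>M borel" by measurable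
  qed
  then show ?thesis using s by (simp add: trajectory_def)
qed

end

theorem corollary1:
  fixes M :: "'a measure" and B :: "nat \<Rightarrow> real \<Rightarrow> 'a \<Rightarrow> real" and H \<rho> T \<delta> :: real
  assumes "prob_space M"
    and "0 < H" and "H < 1"
    and "iid_fractional_BMs M H B"
    and "0 < \<rho>" and "\<rho> < 1 / 2"
    and "T > 1"
    and "\<delta> > 0"
  shows "AE \<omega> in M. \<exists>C::real. eventually (\<lambda>n.
    (SUP (t, \<alpha>)\<in>{0..T} \<times> {\<rho>..1 - \<rho>}.
       ereal \<bar>t powr H * v_emp M B n \<omega> t (tau M B \<alpha> t)
              + exp (- (z_quantile \<alpha>)\<^sup>2 / 2) / sqrt (2 * pi) * u_emp M B n \<omega> t \<alpha>\<bar>)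
    \<le> ereal (C * real n powr (- 1 / 6 + \<delta>))) sequentially"
proof -
  interpret prob_space M by (rule assms(1))
  note H = assms(2,3)
  have T: "0 < T" using assms(7) by simp
  have fBM: "fractional_BM M H (B j)" for j using assms(4) by (simp add: iid_fractional_BMs_def)
  \<comment> \<open>Mesh exponent of the time grid, see \<open>eventually_grid_fine\<close>.\<close>
  define K where "K = nat \<lceil>16 / H\<rceil>"
  have K: "16 / H \<le> real K" unfolding K_def by linarith
  define R where "R = max \<bar>z_quantile \<rho>\<bar> \<bar>z_quantile (1 - \<rho>)\<bar> + 1"
  have R: "0 < R" by (simp add: R_def add_nonneg_pos)
  define w where "w = 17 / phi R"
  have z_bound: "\<bar>z_quantile \<alpha>\<bar> + 1 \<le> R" if "\<alpha> \<in> {\<rho>..1 - \<rho>}" for \<alpha>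
  proof -
    have "Phi (z_quantile \<rho>) \<le> Phi (z_quantile \<alpha>)" "Phi (z_quantile \<alpha>) \<le> Phi (z_quantile (1 - \<rho>))"
      using that assms(5,6) by (auto simp: Phi_z_quantile)
    then have "z_quantile \<rho> \<le> z_quantile \<alpha>" "z_quantile \<alpha> \<le> z_quantile (1 - \<rho>)"
      by (simp_all add: strict_mono_less_eq[OF Phi_strict_mono])
    then show ?thesis unfolding R_def by linarith
  qed
  obtain C where C: "0 < C" and Holder: "AE \<omega> in M. \<forall>\<^sub>F n in sequentially.
      \<forall>j\<in>{1..n}. \<forall>s\<in>{0..T}. \<forall>t\<in>{0..T}. \<bar>B j t \<omega> - B j s \<omega>\<bar> \<le> C * real n * \<bar>t - s\<bar> powr (H / 2)"
    using fBM_Holder_AE[where B = B, OF fBM H(1) T] by (elim exE conjE)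
  have grid: "AE \<omega> in M. \<forall>\<^sub>F n in sequentially.
      grid_regular (\<lambda>s j \<omega>. B j s \<omega> / s powr H) T K (w + 4) n \<omega>"
    by (intro grid_regular_AE iid_fBM_marginals_indep[OF assms(4)] fBM_marginal_cdf[OF fBM] T)
  have start: "AE \<omega> in M. \<forall>j. B j 0 \<omega> = 0"
    unfolding AE_all_countable using fBM_starts_at_0[OF fBM H(1)] by simp
  define C' where "C' = max (T powr H * (10 + w\<^sup>2)) (1 + R + C)"
  have numeric: "\<forall>\<^sub>F n in sequentially. 0 < n \<and> R * real n + 2 \<le> (real n)\<^sup>2 \<and> w * real n powr (- 11/24) \<le> 1
      \<and> R * (T / real (n ^ K)) * real n powr (4 / H)
      + C * real n * (T / real (n ^ K)) powr (H / 2) * real n ^ 4 \<le> 1 / real n"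
  proof (intro eventually_conj eventually_gt_at_top eventually_grid_fine[OF H R T C K])
    show "\<forall>\<^sub>F n in sequentially. R * real n + 2 \<le> (real n)\<^sup>2" using R by real_asymp
    have "0 < w" using normal_density_pos[of 1 0 R] by (simp add: w_def)
    then show "\<forall>\<^sub>F n in sequentially. w * real n powr (- 11/24) \<le> 1" by real_asymp
  qed
  show ?thesis
    using Holder grid start
  proof eventually_elim
    case (elim \<omega>)
    have "\<forall>\<^sub>F n in sequentially.
      (SUP (t, \<alpha>)\<in>{0..T} \<times> {\<rho>..1 - \<rho>}.
       ereal \<bar>t powr H * v_emp M B n \<omega> t (tau M B \<alpha> t)
              + exp (- (z_quantile \<alpha>)\<^sup>2 / 2) / sqrt (2 * pi) * u_emp M B n \<omega> t \<alpha>\<bar>)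
      \<le> ereal (C' * real n powr (- 1 / 6 + \<delta>))"
      using elim(1,2) numeric
    proof eventually_elim
      case (elim n)
      note Hol = elim(1)[rule_format] and gr = elim(2)
      have n: "0 < n" and Rn: "R * real n + 2 \<le> (real n)\<^sup>2" and wn: "w * real n powr (- 11/24) \<le> 1"
        and fine: "R * (T / real (n ^ K)) * real n powr (4 / H)
          + C * real n * (T / real (n ^ K)) powr (H / 2) * real n ^ 4 \<le> 1 / real n"
        using elim(3) by auto
      have n1: "1 \<le> real n" using n by simp
      have main: "\<bar>t powr H * v_emp M B n \<omega> t (tau M B \<alpha> t)
              + exp (- (z_quantile \<alpha>)\<^sup>2 / 2) / sqrt (2 * pi) * u_emp M B n \<omega> t \<alpha>\<bar>
            \<le> C' * real n powr (- 1 / 6)" if t: "t \<in> {0..T}" and \<alpha>: "\<alpha> \<in> {\<rho>..1 - \<rho>}" for t \<alpha>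
      proof -
        define z where "z = z_quantile \<alpha>"
        have \<alpha>01: "0 < \<alpha>" "\<alpha> \<le> 1" "\<alpha> < 1" using \<alpha> assms(5,6) by auto
        have z: "Phi z = \<alpha>" "\<bar>z\<bar> + 1 \<le> R"
          using Phi_z_quantile[OF \<alpha>01(1,3)] z_bound[OF \<alpha>] by (auto simp: z_def)
        have t0: "0 \<le> t" "t \<le> T" using t by auto
        have tau: "tau M B \<alpha> t = t powr H * z"
          using tau_eq[OF fBM H(1) t0(1) \<alpha>01(1,3)] by (simp add: z_def)
        have phi_z: "exp (- (z_quantile \<alpha>)\<^sup>2 / 2) / sqrt (2 * pi) = phi z"
          by (simp add: std_normal_density_def z_def)
        have sqrt_n: "sqrt (real n) = real n powr (1/2)" by (simp add: powr_half_sqrt)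
        show ?thesis
        \<comment> \<open>Below this threshold \<open>t powr H \<le> n powr (- 4)\<close> and the paths are at most \<open>C / n\<close>.\<close>
        proof (cases "real n powr (- 4 / H) \<le> t")
          case True
          then have tpos: "0 < t" using n by (smt (verit) powr_gt_zero of_nat_0_less_iff)
          let ?A = "F_emp B n \<omega> t (t powr H * z) - \<alpha> + phi z * (tau_emp B n \<omega> \<alpha> t / t powr H - z)"
          have cdf: "F_cdf M B t (t powr H * z) = \<alpha>"
            using F_cdf_eq_Phi[where B = B, OF fBM tpos] tpos z by simp
          have "t powr H * v_emp M B n \<omega> t (tau M B \<alpha> t) + phi z * u_emp M B n \<omega> t \<alpha>
              = t powr H * sqrt (real n) * ?A"
            unfolding v_emp_def u_emp_def tau cdf using tpos by (simp add: field_simps)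
          then have "\<bar>t powr H * v_emp M B n \<omega> t (tau M B \<alpha> t) + phi z * u_emp M B n \<omega> t \<alpha>\<bar>
              = t powr H * sqrt (real n) * \<bar>?A\<bar>"
            by (simp add: abs_mult)
          also have "\<dots> \<le> T powr H * sqrt (real n) * ((10 + w\<^sup>2) * real n powr (- 2/3))"
          proof (intro mult_mono)
            show "t powr H \<le> T powr H" using t0 H by (intro powr_mono2) auto
            have "\<bar>?A\<bar> \<le> 2 * (real n powr (- 2/3) + 4 / real n) + (w * real n powr (- 11/24))\<^sup>2"
              unfolding w_def
              by (rule Bahadur_large_time[where B = B and \<omega> = \<omega>, OF H C T R n Rn _ fine Hol _ True t0(2) \<alpha>01(1,2) z])
                 (use wn gr in \<open>auto simp: w_def\<close>)
            also have "\<dots> \<le> (10 + w\<^sup>2) * real n powr (- 2/3)"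
            proof -
              have "1 / real n \<le> real n powr (- 2/3)"
              proof -
                have "1 / real n = real n powr (- 1)" using n by (simp only: powr_neg_one of_nat_0_less_iff)
                also have "\<dots> \<le> real n powr (- 2/3)" using n1 by (intro powr_mono) simp_all
                finally show ?thesis .
              qed
              moreover have "(w * real n powr (- 11/24))\<^sup>2 \<le> w\<^sup>2 * real n powr (- 2/3)"
                unfolding power_mult_distrib powr_square
                using n1 by (intro mult_left_mono powr_mono) auto
              ultimately show ?thesis by (simp add: distrib_right)
            qed
            finally show "\<bar>?A\<bar> \<le> (10 + w\<^sup>2) * real n powr (- 2/3)" .
          qed auto
          also have "\<dots> = T powr H * (10 + w\<^sup>2) * real n powr (- 1/6)"
          proof -
            have "sqrt (real n) * real n powr (- 2/3) = real n powr (- 1/6)"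
              unfolding sqrt_n powr_add[symmetric] by simp
            then show ?thesis by (simp add: mult_ac)
          qed
          also have "\<dots> \<le> C' * real n powr (- 1/6)"
            by (intro mult_right_mono) (auto simp: C'_def)
          finally show ?thesis unfolding phi_z .
        next
          case False
          let ?b = "real n powr (- 4)"
          have b: "t powr H \<le> ?b"
          proof -
            have "t powr H \<le> (real n powr (- 4 / H)) powr H" using False t0 H by (intro powr_mono2) auto
            then show ?thesis using H by (simp add: powr_powr)
          qed
          have small: "\<bar>B j t \<omega>\<bar> \<le> C * real n powr (- 1)" if "j \<in> {1..n}" for j
          proof -
            have "\<bar>B j t \<omega> - B j 0 \<omega>\<bar> \<le> C * real n * \<bar>t - 0\<bar> powr (H / 2)"
              using that t0 T by (intro Hol) auto
            also have "\<dots> \<le> C * real n * (real n powr (- 4 / H)) powr (H / 2)"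
              using False t0 H C by (intro mult_left_mono powr_mono2) auto
            also have "\<dots> = C * (real n powr 1 * real n powr (- 2))"
              using H n by (simp add: powr_powr)
            also have "real n powr 1 * real n powr (- 2) = real n powr (- 1)"
              by (simp only: powr_add[symmetric]) simp
            finally show ?thesis using \<open>\<forall>j. B j 0 \<omega> = 0\<close> by simp
          qed
          have F01: "0 \<le> F_cdf M B t x" "F_cdf M B t x \<le> 1" for x by (auto simp: F_cdf_def)
          have "\<bar>t powr H * v_emp M B n \<omega> t (tau M B \<alpha> t) + phi z * u_emp M B n \<omega> t \<alpha>\<bar>
              \<le> sqrt (real n) * (?b * (1 + R) + C * real n powr (- 1))"
            unfolding v_emp_def u_emp_def tau
            by (rule Bahadur_small_time[where B = B and t = t and \<omega> = \<omega>, OF n \<alpha>01(1,2) small])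
               (use z b phi_le_one[of z] F01 in auto)
          also have "\<dots> \<le> sqrt (real n) * ((1 + R + C) * real n powr (- 1))"
          proof (intro mult_left_mono)
            have "?b \<le> real n powr (- 1)" using n1 by (intro powr_mono) auto
            then have "?b * (1 + R) \<le> real n powr (- 1) * (1 + R)" using R by (intro mult_right_mono) auto
            then show "?b * (1 + R) + C * real n powr (- 1) \<le> (1 + R + C) * real n powr (- 1)"
              by (simp add: algebra_simps)
          qed simp
          also have "\<dots> = (1 + R + C) * real n powr (- 1/2)"
          proof -
            have eq: "sqrt (real n) * real n powr (- 1) = real n powr (- 1/2)"
              unfolding sqrt_n powr_add[symmetric] by simp
            show ?thesis unfolding mult.left_commute[of "sqrt (real n)"] eq ..
          qed
          also have "\<dots> \<le> C' * real n powr (- 1/6)"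
            using n1 R C by (intro mult_mono powr_mono) (auto simp: C'_def)
          finally show ?thesis unfolding phi_z .
        qed
      qed
      show ?case
      proof (rule SUP_least, clarify)
        fix t \<alpha> assume ta: "t \<in> {0..T}" "\<alpha> \<in> {\<rho>..1 - \<rho>}"
        have "C' * real n powr (- 1 / 6) \<le> C' * real n powr (- 1 / 6 + \<delta>)"
          using n1 assms(8) R C by (intro mult_left_mono powr_mono) (auto simp: C'_def)
        then show "ereal \<bar>t powr H * v_emp M B n \<omega> t (tau M B \<alpha> t)
              + exp (- (z_quantile \<alpha>)\<^sup>2 / 2) / sqrt (2 * pi) * u_emp M B n \<omega> t \<alpha>\<bar>
            \<le> ereal (C' * real n powr (- 1 / 6 + \<delta>))"
          using main[OF ta] by (simp only: ereal_less_eq)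
      qed
    qed
    then show ?case by blast
  qed
qed

end
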